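(* Let $(\mathcal L,\mathcal P,\mathcal J)$ be an extremal partial configuration. Then there is a refinement $(\mathcal L',\mathcal P,\mathcal J')$ such that for each line $l\in\mathcal L'$ there are points $p_1,\dots,p_M$ of $\mathcal P$ with $(l,p_j)\in\mathcal J'$, the $p_j$ in order of their position on $l$, and $M\gtrsim N^{1/3-}$, such that for each consecutive pair $p_j,p_{j+1}$ there is a structured set of lines $\mathcal L_j\subset\mathcal L$ each of which intersects $l$ in the open interval bounded by $p_j$ and $p_{j+1}$.
   Context: Conventions: $N$ is a large parameter and $\epsilon_0>0$ a fixed small exponent. $A\lesssim B$ means $A\le CB$ with $C$ independent of $N$; $A\sim B$ means $A\lesssim B\lesssim A$. $N^{a+}$ (resp. $N^{a-}$) denotes $N^{a+\epsilon}$ (resp. $N^{a-\epsilon}$) for some $0\le\epsilon\lesssim\epsilon_0$, possibly different at each occurrence. An extremal partial configuration $(\mathcal L,\mathcal P,\mathcal J)$ consists of a set $\mathcal L$ of lines and a set $\mathcal P$ of points in $\mathbb R^2$ with $N^{1-}\lesssim|\mathcal L|,|\mathcal P|\le N$, and a set $\mathcal J$ of incident pairs $(L,P)\in\mathcal L\times\mathcal P$, $P\in L$, with $|\mathcal J|\gtrsim N^{4/3-}$. A refinement is $(\mathcal L',\mathcal P',\mathcal J')$ with $\mathcal L'\subset\mathcal L$, $\mathcal P'\subset\mathcal P$, $\mathcal J'\subset\mathcal J$ consisting of pairs in $\mathcal L'\times\mathcal P'$, and $|\mathcal L'|\sim|\mathcal L|$, $|\mathcal P'|\sim|\mathcal P|$,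 $|\mathcal J'|\sim|\mathcal J|$. A set of at least $N^{2/3-}$ lines is structured if there is a set of at most $N^{1/3+}$ points such that each of the lines is incident to at least two of these points.
   Formalization: In the refinement, |L'| ~ |L| is relaxed to |L'| ≳ N^{0-}|L| (it fails if many lines of L miss P); the full |L'| ~ |L| is asserted when a positive proportion of the lines of L carry ≳ N^{1/3-} pairs of J, a condition the original conclusion forces. *)

theory Defs
  imports "HOL-Analysis.Analysis"
begin

type_synonym point = "real ^ 2"

definition is_line :: "point set \<Rightarrow> bool" where
  "is_line l \<longleftrightarrow> affine l \<and> aff_dim l = 1"

(* The asymptotic notation is made explicit through three constants: e0 is the fixed small exponent,
   K bounds the exponent losses (0 \<le> e \<le> K * e0, where K does not depend on e0), and C is the
   implied constant of the relations \<lesssim> and \<sim>.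
   The next predicate is  x \<gtrsim> N^{a-}. *)

definition gtrsim_minus :: "real \<Rightarrow> real \<Rightarrow> real \<Rightarrow> real \<Rightarrow> real \<Rightarrow> real \<Rightarrow> bool" where
  "gtrsim_minus K C e0 N a x \<longleftrightarrow> (\<exists>e\<in>{0..K * e0}. N powr (a - e) \<le> C * x)"

definition sim :: "real \<Rightarrow> real \<Rightarrow> real \<Rightarrow> bool" where
  "sim C x y \<longleftrightarrow> x \<le> C * y \<and> y \<le> C * x"

definition extremal_partial_configuration ::
    "real \<Rightarrow> real \<Rightarrow> real \<Rightarrow> real \<Rightarrow> point set set \<Rightarrow> point set \<Rightarrow> (point set \<times> point) set \<Rightarrow> bool" where
  "extremal_partial_configuration K C e0 N \<L> \<P> \<J> \<longleftrightarrow>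
     finite \<L> \<and> finite \<P> \<and> (\<forall>l\<in>\<L>. is_line l) \<and>
     gtrsim_minus K C e0 N 1 (real (card \<L>)) \<and> real (card \<L>) \<le> N \<and>
     gtrsim_minus K C e0 N 1 (real (card \<P>)) \<and> real (card \<P>) \<le> N \<and>
     \<J> \<subseteq> {(l, p) \<in> \<L> \<times> \<P>. p \<in> l} \<and>
     gtrsim_minus K C e0 N (4/3) (real (card \<J>))"

definition refinement ::
    "real \<Rightarrow> point set set \<Rightarrow> point set \<Rightarrow> (point set \<times> point) set \<Rightarrow>
     point set set \<Rightarrow> point set \<Rightarrow> (point set \<times> point) set \<Rightarrow> bool" where
  "refinement C \<L> \<P> \<J> \<L>' \<P>' \<J>' \<longleftrightarrow>
     \<L>' \<subseteq> \<L> \<and> \<P>' \<subseteq> \<P> \<and> \<J>' \<subseteq> \<J> \<and> \<J>' \<subseteq> \<L>' \<times> \<P>' \<and>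
     sim C (real (card \<L>')) (real (card \<L>)) \<and> sim C (real (card \<P>')) (real (card \<P>)) \<and> sim C (real (card \<J>')) (real (card \<J>))"

(* An extremal partial configuration may contain N/2 lines without any incidence, all incidences
   being carried by N^{1-} lines. A subset of lines all of which are rich then cannot satisfy
   |L'| \<sim> |L|; only this comparison is relaxed here, to  N^{-e} |L| \<lesssim> |L'|. *)

definition refinement_up_to_poor_lines ::
    "real \<Rightarrow> real \<Rightarrow> real \<Rightarrow> real \<Rightarrow> point set set \<Rightarrow> point set \<Rightarrow> (point set \<times> point) set \<Rightarrow>
     point set set \<Rightarrow> point set \<Rightarrow> (point set \<times> point) set \<Rightarrow> bool" where
  "refinement_up_to_poor_lines K C e0 N \<L> \<P> \<J> \<L>' \<P>' \<J>' \<longleftrightarrow>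
     \<L>' \<subseteq> \<L> \<and> \<P>' \<subseteq> \<P> \<and> \<J>' \<subseteq> \<J> \<and> \<J>' \<subseteq> \<L>' \<times> \<P>' \<and>
     (\<exists>e\<in>{0..K * e0}. N powr (- e) * real (card \<L>) \<le> C * real (card \<L>')) \<and>
     sim C (real (card \<P>')) (real (card \<P>)) \<and> sim C (real (card \<J>')) (real (card \<J>))"

(* A positive proportion of the lines carry \<gtrsim> N^{1/3-} pairs of J. When it fails for all
   constants, no set of rich lines L' satisfies |L'| \<sim> |L|. *)

definition mostly_rich ::
    "real \<Rightarrow> real \<Rightarrow> real \<Rightarrow> real \<Rightarrow> point set set \<Rightarrow> (point set \<times> point) set \<Rightarrow> bool" where
  "mostly_rich K C e0 N \<L> \<J> \<longleftrightarrow>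
     real (card \<L>) \<le> C * card {l \<in> \<L>. gtrsim_minus K C e0 N (1/3) (card {p. (l, p) \<in> \<J>})}"

definition structured :: "real \<Rightarrow> real \<Rightarrow> real \<Rightarrow> point set set \<Rightarrow> bool" where
  "structured K e0 N S \<longleftrightarrow>
     finite S \<and> (\<forall>m\<in>S. is_line m) \<and>
     (\<exists>e\<in>{0..K * e0}. N powr (2/3 - e) \<le> real (card S)) \<and>
     (\<exists>Q :: point set. finite Q \<and> (\<exists>e\<in>{0..K * e0}. real (card Q) \<le> N powr (1/3 + e)) \<and>
        (\<forall>m\<in>S. \<exists>x\<in>Q. \<exists>y\<in>Q. x \<noteq> y \<and> x \<in> m \<and> y \<in> m))"

(* p 1, ..., p M are distinct points of l, listed in order of position. *)

definition in_order_on :: "point set \<Rightarrow> nat \<Rightarrow> (nat \<Rightarrow> point) \<Rightarrow> bool" where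
  "in_order_on l M p \<longleftrightarrow>
     (\<exists>a v t. v \<noteq> 0 \<and> l = range (\<lambda>s. a + s *\<^sub>R v) \<and> strict_mono_on {1..M} t \<and>
        (\<forall>j\<in>{1..M}. p j = a + t j *\<^sub>R v))"

definition meets_in_open_interval :: "point set \<Rightarrow> point set \<Rightarrow> point \<Rightarrow> point \<Rightarrow> bool" where
  "meets_in_open_interval m l p q \<longleftrightarrow> (\<exists>x \<in> open_segment p q. m \<inter> l = {x})"

end

theory Submission
  imports Defs
begin

text \<open>
  The points are divided into groups by level: for a finite set of lines, let the level of a point
  be the number of lines strictly below it. Cut the range of levels into bands of width \<open>q\<close>, with a
  random offset, and cut the points of each band, ordered by abscissa, into groups of \<open>s\<close>
  consecutive points. A segment of a line that meets \<open>c\<close> other lines leaves its band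
  with probability at most \<open>c / q\<close>, and at most \<open>q\<close> lines stay in a band across any
  vertical cut, so the groups break at most \<open>\<Sum>c / q + q |P| / s\<close> segments. Bounding the unbroken
  segments trivially, by pairs of points in a group, gives the Szemeredi-Trotter bound: segments
  that meet at most \<open>c\<close> lines number \<open>O(|P| \<surd>c)\<close>.

  Apply this twice to the segments between consecutive incidences on each line. Once globally, with
  \<open>q = N\<^sup>2\<^sup>/\<^sup>3\<^sup>+\<close> and \<open>s = N\<^sup>1\<^sup>/\<^sup>3\<^sup>+\<close>: most segments have both ends in one group \<open>Q\<close> of \<open>N\<^sup>1\<^sup>/\<^sup>3\<^sup>+\<close> points.
  Then within each group, for the lines carrying a segment of the group: fewer than \<open>N\<^sup>4\<^sup>/\<^sup>3\<^sup>-\<close>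
  segments are crossed by fewer than \<open>N\<^sup>2\<^sup>/\<^sup>3\<^sup>-\<close> of these lines, each of which has two points in \<open>Q\<close>.
  So most segments are crossed by a structured set. On each line the left ends of such segments
  serve as the points \<open>p\<^sub>j\<close>.
\<close>

section \<open>Lines and segments in coordinates\<close>

text \<open>Points and lines are abstract here; the counting uses only abscissa, ordinate, slope and
  intercept. In the plane, \<open>X\<close> will be a generic shear and \<open>Y\<close> the second
  coordinate.\<close>

locale coordinates =
  fixes X Y :: "'p \<Rightarrow> real" and slope icpt :: "'l \<Rightarrow> real"
begin

definition height :: "'l \<Rightarrow> real \<Rightarrow> real" where
  "height l x = slope l * x + icpt l"

definition on_line :: "'l \<Rightarrow> 'p \<Rightarrow> bool" where
  "on_line l p \<longleftrightarrow> Y p = height l (X p)"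

text \<open>The set \<open>I\<close> is a parameter because closed intervals are what the counting
  uses, while the final structured sets must cross in open intervals.\<close>

definition crossing_lines :: "'l set \<Rightarrow> 'l \<Rightarrow> real set \<Rightarrow> 'l set" where
  "crossing_lines L l I = {m \<in> L. m \<noteq> l \<and> (\<exists>x\<in>I. height m x = height l x)}"

definition level :: "'l set \<Rightarrow> 'l \<Rightarrow> real \<Rightarrow> nat" where
  "level L l x = card {m \<in> L. height m x < height l x}"

definition crossing_number :: "'l set \<Rightarrow> 'l \<times> 'p \<times> 'p \<Rightarrow> nat" where
  "crossing_number L = (\<lambda>(l, p, r). card (crossing_lines L l {X p..X r}))"

text \<open>The last clause makes segments on one line equal as soon as their interiors meet; two
  neighbours may share an endpoint. The first injectivity makes the order of the points by abscissa
  strict, the second makes distinct lines meet at most once.\<close>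

definition segment_system :: "'l set \<Rightarrow> 'p set \<Rightarrow> ('l \<times> 'p \<times> 'p) set \<Rightarrow> bool" where
  "segment_system L P F \<longleftrightarrow>
     finite L \<and> finite P \<and> inj_on X P \<and> inj_on (\<lambda>l. (slope l, icpt l)) L \<and> F \<subseteq> L \<times> P \<times> P \<and>
     (\<forall>l p r. (l, p, r) \<in> F \<longrightarrow> on_line l p \<and> on_line l r \<and> X p < X r) \<and>
     (\<forall>l p r p' r'. (l, p, r) \<in> F \<longrightarrow> (l, p', r') \<in> F \<longrightarrow> X p < X r' \<longrightarrow> X p' < X r \<longrightarrow>
        p = p' \<and> r = r')"

lemma segment_systemD:
  assumes "segment_system L P F"
  shows "finite L" "finite P" "inj_on X P" "inj_on (\<lambda>l. (slope l, icpt l)) L"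
    "F \<subseteq> L \<times> P \<times> P" "finite F"
proof -
  show sub: "F \<subseteq> L \<times> P \<times> P" and fin: "finite L" "finite P"
    and "inj_on X P" "inj_on (\<lambda>l. (slope l, icpt l)) L"
    using assms by (simp_all add: segment_system_def)
  from sub show "finite F" by (rule finite_subset) (simp add: fin)
qed

lemma segment_system_incidence:
  assumes sys: "segment_system L P F" and e: "(l, p, r) \<in> F"
  shows "l \<in> L" "p \<in> P" "r \<in> P" "on_line l p" "on_line l r" "X p < X r"
proof -
  show "l \<in> L" "p \<in> P" "r \<in> P" using segment_systemD(5)[OF sys] e by auto
  have "\<forall>l p r. (l, p, r) \<in> F \<longrightarrow> on_line l p \<and> on_line l r \<and> X p < X r"
    using sys unfolding segment_system_def by (elim conjE)
  then show "on_line l p" "on_line l r" "X p < X r" using e by simp_all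
qed

lemma segment_system_disjoint:
  assumes sys: "segment_system L P F" and "(l, p, r) \<in> F" "(l, p', r') \<in> F" "X p < X r'" "X p' < X r"
  shows "p = p'" "r = r'"
proof -
  have "\<forall>l p r p' r'. (l, p, r) \<in> F \<longrightarrow> (l, p', r') \<in> F \<longrightarrow> X p < X r' \<longrightarrow> X p' < X r \<longrightarrow>
      p = p' \<and> r = r'"
    using sys unfolding segment_system_def by (elim conjE)
  then have "p = p' \<and> r = r'" using assms(2-5) by simp
  then show "p = p'" "r = r'" by simp_all
qed

lemma finite_crossing_lines [simp]: "finite L \<Longrightarrow> finite (crossing_lines L l I)"
  by (simp add: crossing_lines_def)

lemma height_cross_unique:
  assumes "inj_on (\<lambda>l. (slope l, icpt l)) L" "l \<in> L" "m \<in> L" "l \<noteq> m"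
    "height m x = height l x" "height m y = height l y"
  shows "x = y"
proof (rule ccontr)
  assume "x \<noteq> y"
  have "(slope m - slope l) * (x - y) = 0"
    using assms(5,6) by (simp add: height_def algebra_simps)
  with \<open>x \<noteq> y\<close> have "slope m = slope l" by simp
  moreover from this have "icpt m = icpt l" using assms(5) by (simp add: height_def)
  ultimately show False using assms(1-4) by (auto dest: inj_onD)
qed

lemma height_order_change:
  assumes "height m x < height l x" "\<not> height m y < height l y"
  shows "\<exists>z\<in>{min x y..max x y}. height m z = height l z"
proof -
  have cont: "continuous_on S (\<lambda>z. height m z - height l z)" for S
    unfolding height_def by (intro continuous_intros)
  show ?thesis
  proof (cases "x \<le> y")
    case True
    have "\<exists>z\<ge>x. z \<le> y \<and> height m z - height l z = 0"
      by (rule IVT') (use assms True cont in auto)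
    then show ?thesis using True by auto
  next
    case False
    have "\<exists>z\<ge>y. z \<le> x \<and> height m z - height l z = 0"
      by (rule IVT2') (use assms False cont in auto)
    then show ?thesis using False by auto
  qed
qed

text \<open>A line that is below \<open>l\<close> somewhere on the interval but not throughout must
  cross \<open>l\<close> there. So \<open>a\<close> can be the number of lines that stay below
  \<open>l\<close> on the whole interval.\<close>

lemma level_range:
  assumes "finite L"
  obtains a where "\<And>x. x \<in> {u..v} \<Longrightarrow> a \<le> level L l x \<and> level L l x \<le> a + card (crossing_lines L l {u..v})"
proof
  define below where "below = {m \<in> L. \<forall>x\<in>{u..v}. height m x < height l x}"
  fix x assume x: "x \<in> {u..v}"
  have fin: "finite below" using assms by (simp add: below_def)
  have "below \<subseteq> {m \<in> L. height m x < height l x}" using x by (auto simp: below_def)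
  then have 1: "card below \<le> level L l x" unfolding level_def using assms by (intro card_mono) auto
  have "{m \<in> L. height m x < height l x} \<subseteq> below \<union> crossing_lines L l {u..v}"
  proof
    fix m assume m: "m \<in> {m \<in> L. height m x < height l x}"
    show "m \<in> below \<union> crossing_lines L l {u..v}"
    proof (cases "m \<in> below")
      case False
      then obtain y where y: "y \<in> {u..v}" "\<not> height m y < height l y"
        using m by (auto simp: below_def)
      from height_order_change[of m x l y] m y obtain z where
        z: "z \<in> {min x y..max x y}" "height m z = height l z" by auto
      have "z \<in> {u..v}" using z x y by (auto simp: min_def max_def split: if_splits)
      then show ?thesis using m z by (auto simp: crossing_lines_def)
    qed simp
  qed
  then have "level L l x \<le> card (below \<union> crossing_lines L l {u..v})"
    unfolding level_def using assms fin by (intro card_mono) auto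
  also have "\<dots> \<le> card below + card (crossing_lines L l {u..v})" by (rule card_Un_le)
  finally show "card below \<le> level L l x \<and> level L l x \<le> card below + card (crossing_lines L l {u..v})"
    using 1 by simp
qed

end

text \<open>If the offset \<open>k\<close> separates the two values, a multiple of \<open>q\<close>
  occurs among \<open>a + k + 1\<close>, ..., \<open>a + k + c\<close>. For each of these
  \<open>c\<close> positions the offset is determined modulo \<open>q\<close>.\<close>

lemma card_shifts_separating:
  fixes q a c :: nat
  assumes "0 < q"
  shows "card {k \<in> {..<q}. (a + k) div q \<noteq> (a + c + k) div q} \<le> c"
proof -
  have "{k \<in> {..<q}. (a + k) div q \<noteq> (a + c + k) div q} \<subseteq> (\<Union>j\<in>{1..c}. {k \<in> {..<q}. q dvd a + k + j})"
  proof
    fix k assume k: "k \<in> {k \<in> {..<q}. (a + k) div q \<noteq> (a + c + k) div q}"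
    define d where "d = (a + c + k) div q"
    have "(a + k) div q \<le> d" unfolding d_def by (intro div_le_mono) simp
    then have "(a + k) div q < d" using k d_def by simp
    then have 1: "a + k < q * d" using assms
      by (metis div_less_iff_less_mult mult.commute)
    have 2: "q * d \<le> a + c + k" unfolding d_def by simp
    have "q dvd a + k + (q * d - (a + k))" using 1 by simp
    moreover have "q * d - (a + k) \<in> {1..c}" using 1 2 by auto
    ultimately show "k \<in> (\<Union>j\<in>{1..c}. {k \<in> {..<q}. q dvd a + k + j})" using k by blast
  qed
  then have "card {k \<in> {..<q}. (a + k) div q \<noteq> (a + c + k) div q}
      \<le> card (\<Union>j\<in>{1..c}. {k \<in> {..<q}. q dvd a + k + j})"
    by (intro card_mono) auto
  also have "\<dots> \<le> (\<Sum>j\<in>{1..c}. card {k \<in> {..<q}. q dvd a + k + j})"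
    by (intro card_UN_le) simp
  also have "\<dots> \<le> (\<Sum>j\<in>{1..c}. 1)"
  proof (intro sum_mono)
    fix j
    have *: "k \<le> k' \<Longrightarrow> k' < q \<Longrightarrow> q dvd a + k + j \<Longrightarrow> q dvd a + k' + j \<Longrightarrow> k = k'" for k k'
    proof -
      assume h: "k \<le> k'" "k' < q" "q dvd a + k + j" "q dvd a + k' + j"
      have "q dvd (a + k' + j) - (a + k + j)" using h by (intro dvd_diff_nat) auto
      then have "q dvd k' - k" using h by simp
      moreover have "k' - k < q" using h by simp
      ultimately have "k' - k = 0" by (metis nat_dvd_not_less neq0_conv)
      then show "k = k'" using h by simp
    qed
    have "k = k'" if "k \<in> {k \<in> {..<q}. q dvd a + k + j}" "k' \<in> {k \<in> {..<q}. q dvd a + k + j}" for k k'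
      using *[of k k'] *[of k' k] that by (cases "k \<le> k'") auto
    moreover have "finite {k \<in> {..<q}. q dvd a + k + j}" by simp
    ultimately show "card {k \<in> {..<q}. q dvd a + k + j} \<le> 1"
      unfolding One_nat_def by (subst card_le_Suc0_iff_eq) auto
  qed
  finally show ?thesis by simp
qed

lemma card_positive_multiples_le:
  fixes n s :: nat
  assumes "0 < s"
  shows "s * card {i \<in> {..<n}. 0 < i \<and> s dvd i} \<le> n"
proof -
  have "{i \<in> {..<n}. 0 < i \<and> s dvd i} \<subseteq> (\<lambda>j. s * j) ` {1..n div s}"
  proof
    fix i assume i: "i \<in> {i \<in> {..<n}. 0 < i \<and> s dvd i}"
    then obtain j where "i = s * j" by auto
    moreover have "j \<in> {1..n div s}"
      using i \<open>i = s * j\<close> assms by (auto simp: less_eq_div_iff_mult_less_eq mult.commute)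
    ultimately show "i \<in> (\<lambda>j. s * j) ` {1..n div s}" by blast
  qed
  then have "card {i \<in> {..<n}. 0 < i \<and> s dvd i} \<le> card ((\<lambda>j. s * j) ` {1..n div s})"
    by (intro card_mono) auto
  also have "\<dots> \<le> n div s" by (rule order_trans[OF card_image_le]) auto
  finally have "s * card {i \<in> {..<n}. 0 < i \<and> s dvd i} \<le> s * (n div s)" by simp
  also have "\<dots> \<le> n" by simp
  finally show ?thesis .
qed

section \<open>Dividing the points into groups\<close>

lemma sum_card_fibers:
  assumes "finite A"
  shows "(\<Sum>b\<in>f ` A. card {a \<in> A. f a = b}) = card A"
  using sum.image_gen[OF assms, of "\<lambda>_. 1::nat" f] by simp

lemma card_div_fiber_le:
  fixes h :: "'a \<Rightarrow> nat"
  assumes "inj_on h A" "0 < q"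
  shows "card {a \<in> A. h a div q = b} \<le> q"
proof -
  have "h ` {a \<in> A. h a div q = b} \<subseteq> {b * q..<b * q + q}"
    using assms(2) dividend_less_div_times[of q] by (auto simp: add.commute)
  then have "card (h ` {a \<in> A. h a div q = b}) \<le> card {b * q..<b * q + q}"
    by (intro card_mono) auto
  moreover have "card (h ` {a \<in> A. h a div q = b}) = card {a \<in> A. h a div q = b}"
    using assms(1) by (intro card_image) (auto intro: inj_on_subset)
  ultimately show ?thesis by simp
qed

text \<open>Ranks start at 0. With lines for points and heights at a fixed abscissa for
  \<open>X\<close>, the rank is the level of a line.\<close>

definition rank_in :: "'p set \<Rightarrow> ('p \<Rightarrow> real) \<Rightarrow> 'p \<Rightarrow> nat" where
  "rank_in A X p = card {a \<in> A. X a < X p}"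

lemma rank_in_less:
  assumes "finite A" "p \<in> A" "X p < X r"
  shows "rank_in A X p < rank_in A X r"
proof -
  have "{a \<in> A. X a < X p} \<subset> {a \<in> A. X a < X r}" using assms by auto
  then show ?thesis unfolding rank_in_def using assms(1) by (intro psubset_card_mono) auto
qed

lemma rank_in_less_iff:
  assumes "finite A" "p \<in> A" "r \<in> A"
  shows "rank_in A X p < rank_in A X r \<longleftrightarrow> X p < X r"
  using rank_in_less[of A p X r] rank_in_less[of A r X p] assms
  by (cases "X p" "X r" rule: linorder_cases) (auto simp: rank_in_def)

lemma bij_betw_rank_in:
  assumes "finite A" "inj_on X A"
  shows "bij_betw (rank_in A X) A {..<card A}"
proof -
  have inj: "inj_on (rank_in A X) A"
  proof (rule inj_onI)
    fix p r assume "p \<in> A" "r \<in> A" "rank_in A X p = rank_in A X r"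
    then have "\<not> X p < X r" "\<not> X r < X p"
      using rank_in_less_iff[OF assms(1)] by (metis less_irrefl)+
    then show "p = r" using assms(2) \<open>p \<in> A\<close> \<open>r \<in> A\<close> by (auto dest: inj_onD)
  qed
  have "rank_in A X ` A \<subseteq> {..<card A}"
  proof (rule image_subsetI)
    fix p assume "p \<in> A"
    then have "{a \<in> A. X a < X p} \<subset> A" by auto
    then show "rank_in A X p \<in> {..<card A}"
      unfolding rank_in_def using assms(1) by (auto intro: psubset_card_mono)
  qed
  with inj show ?thesis
    unfolding bij_betw_def by (metis card_image card_lessThan card_subset_eq finite_lessThan)
qed

context coordinates
begin

lemma finite_crossings:
  assumes "finite L" "inj_on (\<lambda>l. (slope l, icpt l)) L"
  shows "finite {x. \<exists>l\<in>L. \<exists>m\<in>L. l \<noteq> m \<and> height m x = height l x}"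
proof -
  have "finite {x. l \<noteq> m \<and> height m x = height l x}" if "l \<in> L" "m \<in> L" for l m
  proof (cases "\<exists>x. l \<noteq> m \<and> height m x = height l x")
    case True
    then obtain y where "l \<noteq> m" "height m y = height l y" by blast
    then have "{x. l \<noteq> m \<and> height m x = height l x} \<subseteq> {y}"
      using height_cross_unique[OF assms(2) that] by blast
    then show ?thesis using finite_subset by blast
  next
    case False
    then have "{x. l \<noteq> m \<and> height m x = height l x} = {}" by blast
    then show ?thesis by (metis finite.emptyI)
  qed
  then have "finite (\<Union>l\<in>L. \<Union>m\<in>L. {x. l \<noteq> m \<and> height m x = height l x})"
    using assms(1) by blast
  then show ?thesis by (rule rev_finite_subset) blast
qed

text \<open>Vertical cuts will be made at such abscissae: the levels of the lines are distinct
  there, and the cut runs so close to \<open>c\<close> that every point of \<open>P\<close> left of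
  \<open>c\<close> is also left of the cut. The finitely many crossings cannot fill an
  interval.\<close>

lemma generic_position:
  assumes "finite L" "inj_on (\<lambda>l. (slope l, icpt l)) L" "finite P"
  shows "\<exists>x < c. (\<forall>p\<in>P. X p < c \<longrightarrow> X p < x) \<and> (\<forall>l\<in>L. \<forall>m\<in>L. l \<noteq> m \<longrightarrow> height m x \<noteq> height l x)"
proof -
  \<comment> \<open>The entry \<open>c - 1\<close> is a default for the case that no point of
    \<open>P\<close> lies left of \<open>c\<close>.\<close>
  define u where "u = Max (insert (c - 1) (X ` {p \<in> P. X p < c}))"
  have fin: "finite (insert (c - 1) (X ` {p \<in> P. X p < c}))" using assms(3) by simp
  have "u < c" unfolding u_def using fin by (subst Max_less_iff) auto
  then have "infinite {u<..<c}" by simp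
  then have "\<not> {u<..<c} \<subseteq> {x. \<exists>l\<in>L. \<exists>m\<in>L. l \<noteq> m \<and> height m x = height l x}"
    using finite_crossings[OF assms(1,2)] finite_subset by blast
  then obtain x where x: "x \<in> {u<..<c}" "\<forall>l\<in>L. \<forall>m\<in>L. l \<noteq> m \<longrightarrow> height m x \<noteq> height l x" by blast
  have "X p < x" if "p \<in> P" "X p < c" for p
  proof -
    have "X p \<le> u" unfolding u_def using fin that by (intro Max_ge) auto
    then show ?thesis using x by simp
  qed
  then show ?thesis using x by auto
qed

lemma inj_on_level:
  assumes "finite L" "\<forall>l\<in>L. \<forall>m\<in>L. l \<noteq> m \<longrightarrow> height m x \<noteq> height l x"
  shows "inj_on (\<lambda>l. level L l x) L"
proof -
  have "level L l x = rank_in L (\<lambda>m. height m x) l" for l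
    by (simp add: level_def rank_in_def)
  moreover have "inj_on (\<lambda>m. height m x) L" using assms(2) by (auto intro!: inj_onI)
  ultimately show ?thesis
    using bij_betw_rank_in[OF assms(1)] by (auto simp: bij_betw_def)
qed

section \<open>Bands of levels, cut into chunks by abscissa\<close>

definition broken_segments :: "('p \<Rightarrow> 'g) \<Rightarrow> ('l \<times> 'p \<times> 'p) set \<Rightarrow> ('l \<times> 'p \<times> 'p) set" where
  "broken_segments G F = {(l, p, r) \<in> F. G p \<noteq> G r}"

text \<open>The level is taken at the point itself, without choosing a line; it agrees with the
  level of every line through the point. The offset \<open>k\<close> is averaged over later.\<close>

definition band :: "'l set \<Rightarrow> nat \<Rightarrow> nat \<Rightarrow> 'p \<Rightarrow> nat" where
  "band L q k p = (card {m \<in> L. height m (X p) < Y p} + k) div q"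

definition chunk :: "'l set \<Rightarrow> 'p set \<Rightarrow> nat \<Rightarrow> nat \<Rightarrow> nat \<Rightarrow> 'p \<Rightarrow> nat \<times> nat" where
  "chunk L P q s k p =
     (band L q k p, rank_in {a \<in> P. band L q k a = band L q k p} X p div s)"

text \<open>Every abscissa of the segment is tested, not just the right end: a segment may leave its
  band and return, and the cutting argument concerns segments that stay inside.\<close>

definition band_leaving :: "'l set \<Rightarrow> nat \<Rightarrow> nat \<Rightarrow> ('l \<times> 'p \<times> 'p) set" where
  "band_leaving L q k =
     {(l, p, r). \<exists>x\<in>{X p..X r}. (level L l x + k) div q \<noteq> (level L l (X p) + k) div q}"

lemma band_eq_level: "on_line l p \<Longrightarrow> band L q k p = (level L l (X p) + k) div q"
  by (simp add: band_def level_def on_line_def)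

lemma card_chunk_le:
  assumes "finite P" "inj_on X P" "0 < s"
  shows "card {p \<in> P. chunk L P q s k p = g} \<le> s"
proof -
  obtain b j where g: "g = (b, j)" by (cases g)
  define A where "A = {a \<in> P. band L q k a = b}"
  have "inj_on (rank_in A X) A"
    using bij_betw_rank_in[of A X] assms by (auto simp: bij_betw_def A_def intro: inj_on_subset)
  from card_div_fiber_le[OF this assms(3)] have "card {a \<in> A. rank_in A X a div s = j} \<le> s" .
  moreover have "{p \<in> P. chunk L P q s k p = g} = {a \<in> A. rank_in A X a div s = j}"
    by (auto simp: chunk_def g A_def)
  ultimately show ?thesis by simp
qed

text \<open>Double counting of pairs of an offset and a segment. Along a segment the level varies by
  at most its crossing number, so at most that many of the \<open>q\<close> offsets place a band
  boundary within the range.\<close>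

lemma sum_card_band_leaving_le:
  assumes "finite L" "finite F" "0 < q"
  shows "(\<Sum>k<q. card (F \<inter> band_leaving L q k)) \<le> (\<Sum>e\<in>F. crossing_number L e)"
proof -
  have "(\<Sum>k<q. card (F \<inter> band_leaving L q k)) = (\<Sum>k<q. \<Sum>e\<in>F. of_bool (e \<in> band_leaving L q k))"
    using assms(2) by (simp add: sum.If_cases of_bool_def)
  also have "\<dots> = (\<Sum>e\<in>F. \<Sum>k<q. of_bool (e \<in> band_leaving L q k))" by (rule sum.swap)
  also have "\<dots> = (\<Sum>e\<in>F. card {k \<in> {..<q}. e \<in> band_leaving L q k})"
    by (intro sum.cong refl) (simp add: sum.If_cases of_bool_def Int_def)
  also have "\<dots> \<le> (\<Sum>e\<in>F. crossing_number L e)"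
  proof (intro sum_mono)
    fix e :: "'l \<times> 'p \<times> 'p"
    obtain l p r where e: "e = (l, p, r)" by (cases e)
    define c where "c = card (crossing_lines L l {X p..X r})"
    obtain a where a: "\<And>x. x \<in> {X p..X r} \<Longrightarrow> a \<le> level L l x \<and> level L l x \<le> a + c"
      unfolding c_def by (rule level_range[OF assms(1), where u = "X p" and v = "X r" and l = l]) blast
    \<comment> \<open>If \<open>a\<close> and \<open>a + c\<close> fall into one band, so do all
      levels between them, by monotonicity of \<open>div\<close>.\<close>
    have sub: "(a + k) div q \<noteq> (a + c + k) div q" if "e \<in> band_leaving L q k" for k
    proof
      assume eq: "(a + k) div q = (a + c + k) div q"
      have "(level L l x + k) div q = (a + k) div q" if "x \<in> {X p..X r}" for x
      proof (rule antisym)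
        show "(level L l x + k) div q \<le> (a + k) div q"
          unfolding eq using a[OF that] by (intro div_le_mono) simp
        show "(a + k) div q \<le> (level L l x + k) div q"
          using a[OF that] by (intro div_le_mono) simp
      qed
      moreover obtain x where x: "x \<in> {X p..X r}" "(level L l x + k) div q \<noteq> (level L l (X p) + k) div q"
        using \<open>e \<in> band_leaving L q k\<close> by (auto simp: band_leaving_def e)
      moreover have "X p \<in> {X p..X r}" using x by auto
      ultimately show False by metis
    qed
    have "card {k \<in> {..<q}. e \<in> band_leaving L q k} \<le> card {k \<in> {..<q}. (a + k) div q \<noteq> (a + c + k) div q}"
      using sub by (intro card_mono) auto
    also have "\<dots> \<le> c" by (rule card_shifts_separating[OF assms(3)])
    finally show "card {k \<in> {..<q}. e \<in> band_leaving L q k} \<le> crossing_number L e"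
      by (simp add: e c_def crossing_number_def)
  qed
  finally show ?thesis .
qed

text \<open>A broken segment that stays in its band crosses a cut made just left of the first point
  \<open>z\<close> of some chunk of that band. At such a cut the lines have distinct levels, so at
  most \<open>q\<close> of them are in the band, and each carries at most one segment across the
  cut. There are at most |P| / s such \<open>z\<close>.\<close>

lemma card_broken_inside_band_le:
  assumes sys: "segment_system L P F" and "0 < q" "0 < s"
  shows "s * card (broken_segments (chunk L P q s k) F - band_leaving L q k) \<le> q * card P"
proof -
  note fin = segment_systemD(1,2)[OF sys] and inj = segment_systemD(3)[OF sys]
  define \<beta> where "\<beta> = band L q k"
  define B where "B p = {a \<in> P. \<beta> a = \<beta> p}" for p
  define \<rho> where "\<rho> p = rank_in (B p) X p" for p
  \<comment> \<open>These are the first points of the chunks other than the leftmost chunk of each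
    band. Leaving out rank 0 makes the count at most |P| / s without rounding up in every
    band.\<close>
  define Z where "Z = {z \<in> P. 0 < \<rho> z \<and> s dvd \<rho> z}"
  have finB: "finite (B p)" for p using fin by (simp add: B_def)
  have bij: "bij_betw (rank_in (B p) X) (B p) {..<card (B p)}" for p
    using finB inj by (intro bij_betw_rank_in) (auto simp: B_def intro: inj_on_subset)
  have chunk_eq: "chunk L P q s k p = (\<beta> p, \<rho> p div s)" for p
    by (simp add: chunk_def \<beta>_def \<rho>_def B_def)

  \<comment> \<open>Within one band the ranks embed these points into the positive multiples of
    \<open>s\<close> below the size of the band.\<close>
  have "s * card {z \<in> Z. \<beta> z = b} \<le> card {p \<in> P. \<beta> p = b}" if b: "b \<in> \<beta> ` P" for b
  proof -
    obtain p where p: "p \<in> P" "b = \<beta> p" using b by auto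
    have B: "B z = B p" if "z \<in> P" "\<beta> z = b" for z using that p by (auto simp: B_def)
    have "rank_in (B p) X ` {z \<in> Z. \<beta> z = b} \<subseteq> {i \<in> {..<card (B p)}. 0 < i \<and> s dvd i}"
    proof (rule image_subsetI)
      fix z assume "z \<in> {z \<in> Z. \<beta> z = b}"
      then have z: "z \<in> Z" "b = \<beta> z" by auto
      then have "z \<in> B p" using p by (auto simp: Z_def B_def)
      moreover have "\<rho> z = rank_in (B p) X z" using z B by (auto simp: Z_def \<rho>_def)
      ultimately show "rank_in (B p) X z \<in> {i \<in> {..<card (B p)}. 0 < i \<and> s dvd i}"
        using bij[of p] z by (auto simp: Z_def bij_betw_def)
    qed
    moreover have "inj_on (rank_in (B p) X) {z \<in> Z. \<beta> z = b}"
      using bij[of p] p by (auto simp: bij_betw_def Z_def B_def intro: inj_on_subset)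
    ultimately have "card {z \<in> Z. \<beta> z = b} \<le> card {i \<in> {..<card (B p)}. 0 < i \<and> s dvd i}"
      by (intro card_inj_on_le[where f = "rank_in (B p) X"]) auto
    then have "s * card {z \<in> Z. \<beta> z = b} \<le> s * card {i \<in> {..<card (B p)}. 0 < i \<and> s dvd i}" by simp
    also have "\<dots> \<le> card (B p)" by (rule card_positive_multiples_le[OF assms(3)])
    finally show ?thesis using p by (simp add: B_def)
  qed
  then have "(\<Sum>b\<in>\<beta> ` P. s * card {z \<in> Z. \<beta> z = b}) \<le> (\<Sum>b\<in>\<beta> ` P. card {p \<in> P. \<beta> p = b})"
    by (rule sum_mono)
  moreover have "card Z = (\<Sum>b\<in>\<beta> ` P. card {z \<in> Z. \<beta> z = b})"
  proof -
    have "card Z = (\<Sum>b\<in>\<beta> ` Z. card {z \<in> Z. \<beta> z = b})"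
      using sum_card_fibers[of Z \<beta>] fin by (simp add: Z_def)
    also have "\<dots> = (\<Sum>b\<in>\<beta> ` P. card {z \<in> Z. \<beta> z = b})"
    proof (intro sum.mono_neutral_left ballI)
      show "finite (\<beta> ` P)" "\<beta> ` Z \<subseteq> \<beta> ` P" using fin by (auto simp: Z_def)
      fix b assume "b \<in> \<beta> ` P - \<beta> ` Z"
      then have "{z \<in> Z. \<beta> z = b} = {}" by blast
      then show "card {z \<in> Z. \<beta> z = b} = 0" by (metis card.empty)
    qed
    finally show ?thesis .
  qed
  ultimately have cardZ: "s * card Z \<le> card P"
    using sum_card_fibers[OF fin(2), of \<beta>] by (simp add: sum_distrib_left)

  have "\<forall>z. \<exists>x < X z. (\<forall>p\<in>P. X p < X z \<longrightarrow> X p < x) \<and> (\<forall>l\<in>L. \<forall>m\<in>L. l \<noteq> m \<longrightarrow> height m x \<noteq> height l x)"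
    using generic_position[OF fin(1) segment_systemD(4)[OF sys] fin(2)] by blast
  then obtain \<xi> where \<xi>: "\<And>z. \<xi> z < X z" "\<And>z p. p \<in> P \<Longrightarrow> X p < X z \<Longrightarrow> X p < \<xi> z"
    "\<And>z. \<forall>l\<in>L. \<forall>m\<in>L. l \<noteq> m \<longrightarrow> height m (\<xi> z) \<noteq> height l (\<xi> z)" by metis
  \<comment> \<open>These are the segments that the chunk boundary at \<open>z\<close> can break;
    \<open>\<xi> z\<close> is the generic cut just left of \<open>z\<close>.\<close>
  define E where "E z = {(l, p, r) \<in> F. X p < \<xi> z \<and> \<xi> z < X r \<and> (level L l (\<xi> z) + k) div q = \<beta> z}" for z
  have finE: "finite (E z)" for z
    by (rule finite_subset[OF _ segment_systemD(6)[OF sys]]) (auto simp: E_def)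
  have cardE: "card (E z) \<le> q" for z
  proof -
    have "inj_on fst (E z)"
    proof (rule inj_onI)
      fix e e' assume e: "e \<in> E z" "e' \<in> E z" "fst e = fst e'"
      obtain l p r p' r' where "e = (l, p, r)" "e' = (l, p', r')" using e(3) by (cases e, cases e') auto
      moreover from this have "(l, p, r) \<in> F" "(l, p', r') \<in> F" "X p < X r'" "X p' < X r"
        using e by (auto simp: E_def)
      ultimately show "e = e'" using segment_system_disjoint[OF sys] by metis
    qed
    moreover have "fst ` E z \<subseteq> {l \<in> L. (level L l (\<xi> z) + k) div q = \<beta> z}"
      using segment_system_incidence(1)[OF sys] by (auto simp: E_def)
    ultimately have "card (E z) \<le> card {l \<in> L. (level L l (\<xi> z) + k) div q = \<beta> z}"
      using fin by (auto intro: card_inj_on_le)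
    also have "\<dots> \<le> q"
      using inj_on_level[OF fin(1) \<xi>(3)[of z]] by (intro card_div_fiber_le assms(2)) (auto simp: inj_on_def)
    finally show ?thesis .
  qed
  have "broken_segments (chunk L P q s k) F - band_leaving L q k \<subseteq> (\<Union>z\<in>Z. E z)"
  proof
    fix e assume "e \<in> broken_segments (chunk L P q s k) F - band_leaving L q k"
    moreover obtain l p r where lpr: "e = (l, p, r)" by (cases e)
    ultimately have "(l, p, r) \<in> broken_segments (chunk L P q s k) F" and stay: "(l, p, r) \<notin> band_leaving L q k"
      by auto
    then have e: "(l, p, r) \<in> F" and neq: "chunk L P q s k p \<noteq> chunk L P q s k r"
      by (auto simp: broken_segments_def)
    note inc = segment_system_incidence[OF sys e]
    have \<beta>_level: "\<beta> p = (level L l (X p) + k) div q" "\<beta> r = (level L l (X r) + k) div q"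
      unfolding \<beta>_def by (rule band_eq_level[OF inc(4)], rule band_eq_level[OF inc(5)])
    have lev: "(level L l x + k) div q = \<beta> p" if "x \<in> {X p..X r}" for x
      using stay that unfolding band_leaving_def \<beta>_level by blast
    have \<beta>r: "\<beta> r = \<beta> p" unfolding \<beta>_level(2) using lev[of "X r"] inc(6) by simp
    then have Br: "B r = B p" by (simp add: B_def)
    have mem: "p \<in> B p" "r \<in> B p" using inc \<beta>r by (auto simp: B_def)
    have "\<rho> p < \<rho> r" unfolding \<rho>_def Br using mem finB inc by (simp add: rank_in_less)
    \<comment> \<open>This is the rank of the first point of the chunk of \<open>r\<close>. It
      exceeds the rank of \<open>p\<close>, since \<open>p\<close> lies in an earlier chunk, and in
      particular it is positive.\<close>
    define i where "i = s * (\<rho> r div s)"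
    have "\<rho> p div s < \<rho> r div s"
      using neq \<beta>r \<open>\<rho> p < \<rho> r\<close> by (simp add: chunk_eq) (meson div_le_mono le_neq_implies_less less_imp_le)
    then have i: "\<rho> p < i" "i \<le> \<rho> r" unfolding i_def
      using assms(3) by (metis div_less_iff_less_mult mult.commute, simp)
    have "\<rho> r < card (B p)" using bij[of p] mem Br by (auto simp: \<rho>_def bij_betw_def)
    then have "i \<in> rank_in (B p) X ` B p" using i bij[of p] by (auto simp: bij_betw_def)
    then obtain z where z: "z \<in> B p" "rank_in (B p) X z = i" by auto
    have "B z = B p" using z by (auto simp: B_def)
    then have \<rho>z: "\<rho> z = i" using z by (simp add: \<rho>_def)
    have "X p < X z" using rank_in_less_iff[OF finB mem(1) z(1), of X] i(1) z(2) unfolding \<rho>_def by blast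
    moreover have "\<not> X r < X z" using rank_in_less_iff[OF finB mem(2) z(1), of X] i(2) z(2) unfolding \<rho>_def Br by simp
    ultimately have \<xi>z: "X p < \<xi> z" "\<xi> z < X r"
      using \<xi>(1)[of z] \<xi>(2)[of p z] inc by auto
    have "0 < i" using i(1) by simp
    have "s dvd i" by (simp add: i_def)
    have "z \<in> Z" using z(1) \<rho>z \<open>0 < i\<close> \<open>s dvd i\<close> by (simp add: Z_def B_def)
    moreover have "\<beta> z = \<beta> p" using z by (simp add: B_def)
    ultimately show "e \<in> (\<Union>z\<in>Z. E z)" using lpr e \<xi>z lev[of "\<xi> z"] by (auto simp: E_def)
  qed
  then have "card (broken_segments (chunk L P q s k) F - band_leaving L q k) \<le> card (\<Union>z\<in>Z. E z)"
    using fin finE by (intro card_mono) (auto simp: Z_def)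
  also have "\<dots> \<le> (\<Sum>z\<in>Z. card (E z))" using fin by (intro card_UN_le) (simp add: Z_def)
  also have "\<dots> \<le> card Z * q" using cardE sum_bounded_above[of Z "\<lambda>z. card (E z)" q] by simp
  finally have "s * card (broken_segments (chunk L P q s k) F - band_leaving L q k) \<le> s * (card Z * q)" by simp
  also have "\<dots> = q * (s * card Z)" by simp
  also have "\<dots> \<le> q * card P" using cardZ by (intro mult_left_mono) auto
  finally show ?thesis .
qed

text \<open>Averaging over the \<open>q\<close> offsets: segments leaving their band contribute the
  sum of crossing numbers in total, and those broken inside a band contribute at most q |P| / s for
  each offset. Some offset is no worse than the average.\<close>

lemma partition_breaking_few_segments:
  assumes sys: "segment_system L P F" and "0 < q" "0 < s"
  obtains G :: "'p \<Rightarrow> nat \<times> nat" where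
    "\<And>g. card {p \<in> P. G p = g} \<le> s"
    "q * s * card (broken_segments G F) \<le> s * (\<Sum>e\<in>F. crossing_number L e) + q\<^sup>2 * card P"
proof -
  note fin = segment_systemD(1,2,6)[OF sys]
  define R where "R = s * (\<Sum>e\<in>F. crossing_number L e) + q\<^sup>2 * card P"
  define b where "b k = card (broken_segments (chunk L P q s k) F)" for k
  have "s * b k \<le> s * card (F \<inter> band_leaving L q k) + q * card P" for k
  proof -
    define W where "W = broken_segments (chunk L P q s k) F"
    have "finite W" by (rule finite_subset[OF _ fin(3)]) (auto simp: W_def broken_segments_def)
    then have "card W \<le> card ((F \<inter> band_leaving L q k) \<union> (W - band_leaving L q k))"
      using fin by (intro card_mono) (auto simp: W_def broken_segments_def)
    also have "\<dots> \<le> card (F \<inter> band_leaving L q k) + card (W - band_leaving L q k)"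
      by (rule card_Un_le)
    finally have "s * b k \<le> s * (card (F \<inter> band_leaving L q k) + card (W - band_leaving L q k))"
      by (simp add: b_def W_def)
    also have "\<dots> \<le> s * card (F \<inter> band_leaving L q k) + q * card P"
      using card_broken_inside_band_le[OF assms, of k] by (simp add: W_def distrib_left)
    finally show ?thesis .
  qed
  then have "(\<Sum>k<q. s * b k) \<le> (\<Sum>k<q. s * card (F \<inter> band_leaving L q k) + q * card P)"
    by (rule sum_mono)
  also have "\<dots> = s * (\<Sum>k<q. card (F \<inter> band_leaving L q k)) + q\<^sup>2 * card P"
    by (simp add: sum.distrib sum_distrib_left power2_eq_square)
  also have "\<dots> \<le> R"
    unfolding R_def using sum_card_band_leaving_le[OF fin(1,3) assms(2)] by simp
  finally have sum: "(\<Sum>k<q. s * b k) \<le> R" .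
  have "\<exists>k<q. q * s * b k \<le> R"
  proof (rule ccontr)
    assume "\<not> ?thesis"
    then have "(\<Sum>k<q. R) < (\<Sum>k<q. q * s * b k)"
      using assms(2) by (intro sum_strict_mono) (auto simp: not_le)
    also have "\<dots> = q * (\<Sum>k<q. s * b k)" by (simp add: sum_distrib_left mult.assoc)
    also have "\<dots> \<le> q * R" using sum by simp
    finally show False by simp
  qed
  then obtain k where k: "q * s * b k \<le> R" by blast
  show ?thesis
  proof (rule that)
    show "card {p \<in> P. chunk L P q s k p = g} \<le> s" for g
      by (rule card_chunk_le[OF fin(2) segment_systemD(3)[OF sys] assms(3)])
    show "q * s * card (broken_segments (chunk L P q s k) F)
        \<le> s * (\<Sum>e\<in>F. crossing_number L e) + q\<^sup>2 * card P"
      using k unfolding b_def R_def .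
  qed
qed

end

section \<open>Counting segments\<close>

context coordinates
begin

lemma finite_broken_segments: "finite F \<Longrightarrow> finite (broken_segments G F)"
  by (rule finite_subset) (auto simp: broken_segments_def)

lemma broken_segments_subset: "broken_segments G F \<subseteq> F"
  by (auto simp: broken_segments_def)

lemma on_line_unique:
  assumes "inj_on (\<lambda>l. (slope l, icpt l)) L" "l \<in> L" "m \<in> L"
    "on_line l p" "on_line m p" "on_line l r" "on_line m r" "X p \<noteq> X r"
  shows "l = m"
  using height_cross_unique[OF assms(1-3), of "X p" "X r"] assms(4-8)
  by (auto simp: on_line_def)

text \<open>Two points of different abscissae lie on at most one common line, so a segment is
  determined by its ends. An unbroken one has its right end among the at most \<open>s\<close>
  points in the group of its left end.\<close>

lemma card_unbroken_le:
  assumes sys: "segment_system L P F" and fib: "\<And>g. card {p \<in> P. G p = g} \<le> s"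
  shows "card (F - broken_segments G F) \<le> s * card P"
proof -
  note fin = segment_systemD(2)[OF sys]
  have "inj_on snd F"
  proof (rule inj_onI)
    fix e e' assume e: "e \<in> F" "e' \<in> F" "snd e = snd e'"
    obtain l m p r where lm: "e = (l, p, r)" "e' = (m, p, r)" using e(3) by (cases e, cases e') auto
    then have "l = m"
      using segment_system_incidence[OF sys, of l p r] segment_system_incidence[OF sys, of m p r] e
        on_line_unique[OF segment_systemD(4)[OF sys], of l m p r] by auto
    then show "e = e'" using lm by simp
  qed
  then have "inj_on snd (F - broken_segments G F)" by (rule inj_on_subset) auto
  moreover have "snd ` (F - broken_segments G F) \<subseteq> (SIGMA p:P. {r \<in> P. G r = G p})"
    using segment_systemD(5)[OF sys] by (auto simp: broken_segments_def)
  moreover have "finite (SIGMA p:P. {r \<in> P. G r = G p})" using fin by auto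
  ultimately have "card (F - broken_segments G F) \<le> card (SIGMA p:P. {r \<in> P. G r = G p})"
    by (rule card_inj_on_le)
  also have "\<dots> = (\<Sum>p\<in>P. card {r \<in> P. G r = G p})" using fin by (intro card_SigmaI) auto
  also have "\<dots> \<le> card P * s" using fib sum_bounded_above[of P "\<lambda>p. card {r \<in> P. G r = G p}" s] by simp
  finally show ?thesis by (simp add: mult.commute)
qed

text \<open>The band width \<open>s\<^sup>2\<close> balances the two errors: segments broken inside
  a band and unbroken segments each number at most s |P|.\<close>

lemma segment_count_bound:
  assumes sys: "segment_system L P F" and "0 < s"
  shows "s\<^sup>2 * card F \<le> (\<Sum>e\<in>F. crossing_number L e) + 2 * s ^ 3 * card P"
proof -
  define c where "c = (\<Sum>e\<in>F. crossing_number L e)"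
  obtain G :: "'p \<Rightarrow> nat \<times> nat" where
    fib: "\<And>g. card {p \<in> P. G p = g} \<le> s" and
    br: "s\<^sup>2 * s * card (broken_segments G F) \<le> s * c + (s\<^sup>2)\<^sup>2 * card P"
    unfolding c_def
    by (rule partition_breaking_few_segments[OF sys, of "s\<^sup>2" s]) (use assms(2) in auto)
  have "s * (s\<^sup>2 * card (broken_segments G F)) \<le> s * (c + s ^ 3 * card P)"
    using br by (simp add: algebra_simps power2_eq_square power3_eq_cube)
  then have 1: "s\<^sup>2 * card (broken_segments G F) \<le> c + s ^ 3 * card P" using assms(2) by simp
  have 2: "s\<^sup>2 * card (F - broken_segments G F) \<le> s ^ 3 * card P"
    using mult_le_mono2[OF card_unbroken_le[OF sys fib], of "s\<^sup>2"]
    by (simp add: power2_eq_square power3_eq_cube mult.assoc)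
  have "card F = card (broken_segments G F) + card (F - broken_segments G F)"
    using segment_systemD(6)[OF sys] broken_segments_subset[of G F]
    by (metis card_Diff_subset card_mono finite_broken_segments le_add_diff_inverse)
  then show ?thesis using 1 2 unfolding c_def by (simp add: distrib_left)
qed

text \<open>This is the Szemeredi-Trotter bound, with \<open>s\<close> of the order of the square
  root of \<open>c\<close>: the sum of crossing numbers is then at most half of the left side of the
  previous bound and is absorbed.\<close>

lemma segment_count_bound_few_crossings:
  assumes sys: "segment_system L P F" and "0 < s"
    and "\<And>e. e \<in> F \<Longrightarrow> crossing_number L e \<le> c" "2 * c \<le> s\<^sup>2"
  shows "card F \<le> 4 * s * card P"
proof -
  have "(\<Sum>e\<in>F. crossing_number L e) \<le> card F * c"
    using sum_bounded_above[of F "crossing_number L" c] assms(3) by simp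
  with segment_count_bound[OF sys assms(2)]
  have "2 * (s\<^sup>2 * card F) \<le> card F * (2 * c) + 4 * s ^ 3 * card P" by simp
  also have "\<dots> \<le> card F * s\<^sup>2 + 4 * s ^ 3 * card P" using assms(4) by simp
  finally have "s\<^sup>2 * card F \<le> s\<^sup>2 * (4 * s * card P)"
    by (simp add: algebra_simps power2_eq_square power3_eq_cube)
  then show ?thesis using assms(2) by simp
qed

text \<open>Two lines meet at most once, and the meeting point lies in at most two closed segments
  of \<open>l\<close>, namely two neighbours when it is their common endpoint. Hence the factor 2
  for each ordered pair of lines.\<close>

lemma sum_crossing_number_le:
  assumes sys: "segment_system L P F"
  shows "(\<Sum>e\<in>F. crossing_number L e) \<le> 2 * (card L)\<^sup>2"
proof -
  note fin = segment_systemD(1,6)[OF sys]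
  define cr where "cr m e = (case e of (l, p, r) \<Rightarrow> m \<in> crossing_lines L l {X p..X r})" for m e
  have two: "card {e \<in> F. fst e = l \<and> cr m e} \<le> 2" if l: "l \<in> L" and m: "m \<in> L" for l m
  proof (cases "{e \<in> F. fst e = l \<and> cr m e} = {}")
    case False
    then obtain x where x: "m \<noteq> l" "height m x = height l x"
      by (auto simp: cr_def crossing_lines_def)
    have uniq: "y = x" if "height m y = height l y" for y
      using height_cross_unique[OF segment_systemD(4)[OF sys] l m] x that by metis
    \<comment> \<open>Closed segments containing \<open>x\<close> are split into two half-open
      kinds. Each kind has at most one member by disjointness, and together they cover all, since
      segments have positive length.\<close>
    define A where "A = {(l', p, r) \<in> F. l' = l \<and> X p \<le> x \<and> x < X r}"
    define B where "B = {(l', p, r) \<in> F. l' = l \<and> X p < x \<and> x \<le> X r}"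
    have finAB: "finite A" "finite B"
      by (rule finite_subset[OF _ fin(2)]; auto simp: A_def B_def)+
    have "card A \<le> 1" "card B \<le> 1"
      unfolding One_nat_def using finAB segment_system_disjoint[OF sys]
      by (subst card_le_Suc0_iff_eq; force simp: A_def B_def)+
    have "{e \<in> F. fst e = l \<and> cr m e} \<subseteq> A \<union> B"
    proof
      fix e assume e: "e \<in> {e \<in> F. fst e = l \<and> cr m e}"
      then obtain p r where pr: "e = (l, p, r)" by (cases e) auto
      then obtain y where "y \<in> {X p..X r}" "height m y = height l y"
        using e by (auto simp: cr_def crossing_lines_def)
      then have "X p \<le> x" "x \<le> X r" "X p < X r" "(l, p, r) \<in> F"
        using uniq e pr segment_system_incidence(6)[OF sys] by auto
      then show "e \<in> A \<union> B" using pr by (auto simp: A_def B_def)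
    qed
    then have "card {e \<in> F. fst e = l \<and> cr m e} \<le> card (A \<union> B)" using finAB by (intro card_mono) auto
    also have "\<dots> \<le> 2" using card_Un_le[of A B] \<open>card A \<le> 1\<close> \<open>card B \<le> 1\<close> by simp
    finally show ?thesis .
  qed (simp only: card.empty)
  have "crossing_number L e = (\<Sum>m\<in>L. of_bool (cr m e))" for e
  proof -
    obtain l p r where e: "e = (l, p, r)" by (cases e)
    have "crossing_lines L l {X p..X r} = {m \<in> L. cr m e}"
      by (auto simp: e cr_def crossing_lines_def)
    then show ?thesis using fin by (simp add: e crossing_number_def sum.If_cases of_bool_def Int_def)
  qed
  then have "(\<Sum>e\<in>F. crossing_number L e) = (\<Sum>e\<in>F. \<Sum>m\<in>L. of_bool (cr m e))" by simp
  also have "\<dots> = (\<Sum>m\<in>L. \<Sum>e\<in>F. of_bool (cr m e))" by (rule sum.swap)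
  also have "\<dots> = (\<Sum>m\<in>L. card {e \<in> F. cr m e})"
    using fin by (simp add: sum.If_cases of_bool_def Int_def)
  also have "\<dots> \<le> (\<Sum>m\<in>L. \<Sum>l\<in>L. 2)"
  proof (rule sum_mono)
    fix m assume m: "m \<in> L"
    have "{e \<in> F. cr m e} \<subseteq> (\<Union>l\<in>L. {e \<in> F. fst e = l \<and> cr m e})"
      using segment_systemD(5)[OF sys] by auto
    then have "card {e \<in> F. cr m e} \<le> card (\<Union>l\<in>L. {e \<in> F. fst e = l \<and> cr m e})"
      using fin by (intro card_mono) auto
    also have "\<dots> \<le> (\<Sum>l\<in>L. card {e \<in> F. fst e = l \<and> cr m e})" by (rule card_UN_le[OF fin(1)])
    also have "\<dots> \<le> (\<Sum>l\<in>L. 2)" using two m by (intro sum_mono) auto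
    finally show "card {e \<in> F. cr m e} \<le> (\<Sum>l\<in>L. 2)" .
  qed
  also have "\<dots> = 2 * (card L)\<^sup>2" by (simp add: power2_eq_square)
  finally show ?thesis .
qed

section \<open>Consecutive incidences and crossings by structured sets\<close>

definition consecutive :: "('l \<times> 'p) set \<Rightarrow> ('l \<times> 'p \<times> 'p) set" where
  "consecutive J = {(l, p, r). (l, p) \<in> J \<and> (l, r) \<in> J \<and> X p < X r \<and>
     (\<forall>z. (l, z) \<in> J \<longrightarrow> X z \<le> X p \<or> X r \<le> X z)}"

lemma segment_system_consecutive:
  assumes "finite L" "finite P" "inj_on X P" "inj_on (\<lambda>l. (slope l, icpt l)) L"
    "J \<subseteq> {(l, p) \<in> L \<times> P. on_line l p}"
  shows "segment_system L P (consecutive J)"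
  unfolding segment_system_def
proof (intro conjI allI impI)
  show "consecutive J \<subseteq> L \<times> P \<times> P" using assms(5) by (auto simp: consecutive_def)
  fix l p r assume e: "(l, p, r) \<in> consecutive J"
  then show "on_line l p" "on_line l r" "X p < X r" using assms(5) by (auto simp: consecutive_def)
  fix p' r' assume e': "(l, p', r') \<in> consecutive J" "X p < X r'" "X p' < X r"
  have J: "(l, p) \<in> J" "(l, r) \<in> J" "(l, p') \<in> J" "(l, r') \<in> J"
    using e e' by (auto simp: consecutive_def)
  have sep: "(l, z) \<in> J \<Longrightarrow> X z \<le> X p \<or> X r \<le> X z" "(l, z) \<in> J \<Longrightarrow> X z \<le> X p' \<or> X r' \<le> X z" for z
    using e e' by (auto simp: consecutive_def)
  have "X p = X p'" using sep(1)[OF J(3)] sep(2)[OF J(1)] e'(2,3) by auto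
  moreover have "X r = X r'" using sep(1)[OF J(4)] sep(2)[OF J(2)] e'(2,3) by auto
  ultimately show "p = p'" "r = r'" using assms(3,5) J by (auto dest: inj_onD)
qed (use assms in auto)

text \<open>Every incidence on \<open>l\<close> except the rightmost is the left end of a
  consecutive segment; the rightmost accounts for the \<open>+ 1\<close>.\<close>

lemma card_incidences_le_consecutive:
  assumes "finite J" "inj_on X (snd ` J)"
  shows "card {p. (l, p) \<in> J} \<le> card {e \<in> consecutive J. fst e = l} + 1"
proof (cases "{p. (l, p) \<in> J} = {}")
  case False
  define A where "A = {p. (l, p) \<in> J}"
  have "A \<subseteq> snd ` J" by (force simp: A_def)
  then have finA: "finite A" and inj: "inj_on X A"
    using assms by (auto intro: finite_subset inj_on_subset)
  obtain w where w: "w \<in> A" "\<And>p. p \<in> A \<Longrightarrow> X p \<le> X w"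
  proof -
    have "Max (X ` A) \<in> X ` A" using finA False by (intro Max_in) (auto simp: A_def)
    then obtain w where "w \<in> A" "X w = Max (X ` A)" by auto
    then show ?thesis using that finA by simp
  qed
  have "A - {w} \<subseteq> (\<lambda>e. fst (snd e)) ` {e \<in> consecutive J. fst e = l}"
  proof
    fix p assume p: "p \<in> A - {w}"
    then have "X p < X w" using w inj by (metis DiffD1 DiffD2 inj_onD less_eq_real_def singletonI)
    define U where "U = {r \<in> A. X p < X r}"
    have "finite U" "U \<noteq> {}" using finA w \<open>X p < X w\<close> by (auto simp: U_def)
    then have "Min (X ` U) \<in> X ` U" by simp
    then obtain r where r: "r \<in> U" "X r = Min (X ` U)" by auto
    have "X r \<le> X z" if "z \<in> A" "X p < X z" for z
      using that \<open>finite U\<close> r(2) by (simp add: U_def)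
    then have "(l, p, r) \<in> consecutive J"
      using p r(1) by (auto simp: consecutive_def A_def U_def not_less[symmetric])
    then show "p \<in> (\<lambda>e. fst (snd e)) ` {e \<in> consecutive J. fst e = l}" by force
  qed
  moreover have "finite {e \<in> consecutive J. fst e = l}"
  proof (rule finite_subset)
    show "{e \<in> consecutive J. fst e = l} \<subseteq> {l} \<times> A \<times> A" by (auto simp: consecutive_def A_def)
  qed (use finA in auto)
  ultimately have "card (A - {w}) \<le> card {e \<in> consecutive J. fst e = l}"
    by (meson card_image_le card_mono finite_imageI le_trans)
  then show ?thesis using finA w(1) by (simp add: A_def[symmetric])
qed (simp only: card.empty)

text \<open>Each of these lines contains two distinct points of the group \<open>g\<close> when
  \<open>F\<close> is a segment system. A large set of them is therefore structured, with the group
  as its set of points.\<close>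

definition local_lines :: "('p \<Rightarrow> 'g) \<Rightarrow> ('l \<times> 'p \<times> 'p) set \<Rightarrow> 'g \<Rightarrow> 'l set" where
  "local_lines G F g = {l. \<exists>p r. (l, p, r) \<in> F \<and> G p = g \<and> G r = g}"

text \<open>The interval is open because the conclusion asks for crossings strictly between the two
  ends; local lines through an end are bounded separately.\<close>

definition rich_segments :: "('p \<Rightarrow> 'g) \<Rightarrow> nat \<Rightarrow> ('l \<times> 'p \<times> 'p) set \<Rightarrow> ('l \<times> 'p \<times> 'p) set" where
  "rich_segments G t F = {(l, p, r) \<in> F. G p = G r \<and>
     t \<le> card (crossing_lines (local_lines G F (G p)) l {X p<..<X r})}"

lemma local_lines_subset:
  assumes "segment_system L P F"
  shows "local_lines G F g \<subseteq> L"
  using segment_systemD(5)[OF assms] by (auto simp: local_lines_def)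

text \<open>Each local line through \<open>p\<close> also contains a point of the group at another
  abscissa, and this point together with \<open>p\<close> determines the line. So the local lines
  through \<open>p\<close> inject into the group.\<close>

lemma card_local_lines_through_le:
  assumes sys: "segment_system L P F" and p: "p \<in> P"
  shows "card {m \<in> local_lines G F g. on_line m p} \<le> card {a \<in> P. G a = g}"
proof -
  note inj = segment_systemD(4)[OF sys]
  have "\<exists>w. w \<in> P \<and> G w = g \<and> X w \<noteq> X p \<and> on_line m w" if m: "m \<in> local_lines G F g" for m
  proof -
    obtain u v where "(m, u, v) \<in> F" "G u = g" "G v = g" using m unfolding local_lines_def by blast
    then show ?thesis using segment_system_incidence[OF sys, of m u v] by (cases "X u = X p") auto
  qed
  then obtain w where w: "\<And>m. m \<in> local_lines G F g \<Longrightarrow> w m \<in> P \<and> G (w m) = g \<and> X (w m) \<noteq> X p \<and> on_line m (w m)"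
    by metis
  have "inj_on w {m \<in> local_lines G F g. on_line m p}"
  proof (rule inj_onI)
    fix l m assume lm: "l \<in> {m \<in> local_lines G F g. on_line m p}" "m \<in> {m \<in> local_lines G F g. on_line m p}" "w l = w m"
    then show "l = m"
      using on_line_unique[OF inj, of l m p "w l"] w[of l] w[of m] local_lines_subset[OF sys, of G g] by auto
  qed
  moreover have "w ` {m \<in> local_lines G F g. on_line m p} \<subseteq> {a \<in> P. G a = g}" using w by auto
  ultimately show ?thesis using segment_systemD(2)[OF sys] by (intro card_inj_on_le) auto
qed

text \<open>The Szemeredi-Trotter bound is applied inside each group, to its own points and local
  lines only. The term \<open>2 * s\<close> pays for local lines through the two ends, which closed
  crossing numbers include. The group sizes add up to |P|.\<close>

lemma card_poor_segments_le:
  assumes sys: "segment_system L P F" and fib: "\<And>g. card {p \<in> P. G p = g} \<le> s"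
    and \<sigma>: "0 < \<sigma>" "2 * (t + 2 * s) \<le> \<sigma>\<^sup>2"
  shows "card (F - broken_segments G F - rich_segments G t F) \<le> 4 * \<sigma> * card P"
proof -
  note fin = segment_systemD(1,2,6)[OF sys]
  define S where "S = local_lines G F"
  define bad where "bad g = {(l, p, r) \<in> F. G p = g \<and> G r = g \<and> card (crossing_lines (S g) l {X p<..<X r}) < t}" for g
  have SL: "S g \<subseteq> L" for g unfolding S_def by (rule local_lines_subset[OF sys])
  have finS: "finite (S g)" for g using SL fin(1) finite_subset by blast
  have badF: "bad g \<subseteq> F" for g by (auto simp: bad_def)
  have bound: "card (bad g) \<le> 4 * \<sigma> * card {p \<in> P. G p = g}" for g
  proof (rule segment_count_bound_few_crossings[OF _ \<sigma>(1)])
    show "segment_system (S g) {p \<in> P. G p = g} (bad g)"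
      unfolding segment_system_def
    proof (intro conjI)
      show "inj_on X {p \<in> P. G p = g}" using segment_systemD(3)[OF sys] by (rule inj_on_subset) auto
      show "inj_on (\<lambda>l. (slope l, icpt l)) (S g)" using segment_systemD(4)[OF sys] SL by (rule inj_on_subset)
      show "bad g \<subseteq> S g \<times> {p \<in> P. G p = g} \<times> {p \<in> P. G p = g}"
        using segment_systemD(5)[OF sys] by (auto simp: bad_def S_def local_lines_def)
      show "\<forall>l p r. (l, p, r) \<in> bad g \<longrightarrow> on_line l p \<and> on_line l r \<and> X p < X r"
        using segment_system_incidence[OF sys] badF[of g] by (meson subsetD)
      show "\<forall>l p r p' r'. (l, p, r) \<in> bad g \<longrightarrow> (l, p', r') \<in> bad g \<longrightarrow> X p < X r' \<longrightarrow>
          X p' < X r \<longrightarrow> p = p' \<and> r = r'"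
        using segment_system_disjoint[OF sys] badF[of g] by (meson subsetD)
    qed (use finS fin in auto)
    show "2 * (t + 2 * s) \<le> \<sigma>\<^sup>2" by (rule \<sigma>(2))
    fix e assume "e \<in> bad g"
    moreover obtain l p r where e: "e = (l, p, r)" by (cases e)
    ultimately have F: "(l, p, r) \<in> F" and few: "card (crossing_lines (S g) l {X p<..<X r}) < t"
      by (auto simp: bad_def)
    note inc = segment_system_incidence[OF sys F]
    have thru: "card {m \<in> S g. on_line m a} \<le> s" if "a \<in> P" for a
      using card_local_lines_through_le[OF sys that, of G g] fib[of g] by (simp add: S_def)
    have "crossing_lines (S g) l {X p..X r} \<subseteq>
        crossing_lines (S g) l {X p<..<X r} \<union> ({m \<in> S g. on_line m p} \<union> {m \<in> S g. on_line m r})"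
    proof
      fix m assume "m \<in> crossing_lines (S g) l {X p..X r}"
      then obtain x where m: "m \<in> S g" "m \<noteq> l" and x: "X p \<le> x" "x \<le> X r" "height m x = height l x"
        by (auto simp: crossing_lines_def)
      consider "x = X p" | "x = X r" | "X p < x" "x < X r" using x by linarith
      then show "m \<in> crossing_lines (S g) l {X p<..<X r} \<union> ({m \<in> S g. on_line m p} \<union> {m \<in> S g. on_line m r})"
        using m x inc(4,5) by cases (auto simp: on_line_def crossing_lines_def)
    qed
    then have "card (crossing_lines (S g) l {X p..X r}) \<le>
        card (crossing_lines (S g) l {X p<..<X r} \<union> ({m \<in> S g. on_line m p} \<union> {m \<in> S g. on_line m r}))"
      using finS by (intro card_mono) auto
    also have "\<dots> \<le> card (crossing_lines (S g) l {X p<..<X r}) + (card {m \<in> S g. on_line m p} + card {m \<in> S g. on_line m r})"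
      by (meson add_left_mono card_Un_le order_trans)
    also have "\<dots> \<le> t + 2 * s" using few thru[OF inc(2)] thru[OF inc(3)] by simp
    finally show "crossing_number (S g) e \<le> t + 2 * s" by (simp add: e crossing_number_def)
  qed
  have "F - broken_segments G F - rich_segments G t F \<subseteq> (\<Union>g\<in>G ` P. bad g)"
    using segment_systemD(5)[OF sys]
    by (auto simp: broken_segments_def rich_segments_def bad_def S_def)
  then have "card (F - broken_segments G F - rich_segments G t F) \<le> card (\<Union>g\<in>G ` P. bad g)"
    using fin badF by (intro card_mono) (auto intro: finite_subset)
  also have "\<dots> \<le> (\<Sum>g\<in>G ` P. card (bad g))" using fin by (intro card_UN_le) auto
  also have "\<dots> \<le> (\<Sum>g\<in>G ` P. 4 * \<sigma> * card {p \<in> P. G p = g})" by (intro sum_mono bound)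
  also have "\<dots> = 4 * \<sigma> * card P"
    using sum_card_fibers[OF fin(2), of G] by (simp add: sum_distrib_left[symmetric])
  finally show ?thesis .
qed

text \<open>A version of being crossed by a structured set with plain thresholds \<open>t\<close>
  and \<open>s\<close> in place of powers of \<open>N\<close>.\<close>

definition crossed_by_structured :: "'l set \<Rightarrow> 'p set \<Rightarrow> nat \<Rightarrow> nat \<Rightarrow> 'l \<times> 'p \<times> 'p \<Rightarrow> bool" where
  "crossed_by_structured L P s t = (\<lambda>(l, p, r). \<exists>S\<subseteq>crossing_lines L l {X p<..<X r}. \<exists>Q\<subseteq>P.
     t \<le> card S \<and> card Q \<le> s \<and>
     (\<forall>m\<in>S. \<exists>u\<in>Q. \<exists>v\<in>Q. u \<noteq> v \<and> on_line m u \<and> on_line m v))"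

text \<open>The local lines crossing the segment form \<open>S\<close>, and the common group of its
  ends is \<open>Q\<close>.\<close>

lemma rich_segment_crossed_by_structured:
  assumes sys: "segment_system L P F" and fib: "\<And>g. card {p \<in> P. G p = g} \<le> s"
    and e: "e \<in> rich_segments G t F"
  shows "crossed_by_structured L P s t e"
proof -
  obtain l p r where lpr: "e = (l, p, r)" by (cases e)
  define S where "S = crossing_lines (local_lines G F (G p)) l {X p<..<X r}"
  have "\<exists>u\<in>{a \<in> P. G a = G p}. \<exists>v\<in>{a \<in> P. G a = G p}. u \<noteq> v \<and> on_line m u \<and> on_line m v"
    if m: "m \<in> S" for m
  proof -
    obtain u v where uv: "(m, u, v) \<in> F" "G u = G p" "G v = G p"
      using m unfolding S_def crossing_lines_def local_lines_def by blast
    with segment_system_incidence[OF sys uv(1)] show ?thesis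
      by (intro bexI[of _ u] bexI[of _ v]) auto
  qed
  moreover have "S \<subseteq> crossing_lines L l {X p<..<X r}"
    using local_lines_subset[OF sys, of G "G p"] by (auto simp: S_def crossing_lines_def)
  moreover have "t \<le> card S" using e unfolding lpr rich_segments_def S_def by blast
  moreover have "{a \<in> P. G a = G p} \<subseteq> P" by blast
  ultimately show ?thesis using fib[of "G p"]
    unfolding crossed_by_structured_def lpr prod.case
    by (intro exI[of _ S] exI[of _ "{a \<in> P. G a = G p}"] conjI ballI) auto
qed

text \<open>A segment that fails is either broken by the grouping or poor inside its group. After
  division by \<open>q * s\<close> the three terms count segments leaving a band, segments broken
  inside a band, and poor segments.\<close>

lemma most_segments_crossed_by_structured:
  assumes sys: "segment_system L P F" and "0 < q" "0 < s" "0 < \<sigma>" "2 * (t + 2 * s) \<le> \<sigma>\<^sup>2"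
  shows "q * s * card {e \<in> F. \<not> crossed_by_structured L P s t e} \<le>
    2 * s * (card L)\<^sup>2 + q\<^sup>2 * card P + 4 * q * s * \<sigma> * card P"
proof -
  obtain G :: "'p \<Rightarrow> nat \<times> nat" where
    fib: "\<And>g. card {p \<in> P. G p = g} \<le> s" and
    br: "q * s * card (broken_segments G F) \<le> s * (\<Sum>e\<in>F. crossing_number L e) + q\<^sup>2 * card P"
    by (rule partition_breaking_few_segments[OF sys assms(2,3)]) blast
  define poor where "poor = F - broken_segments G F - rich_segments G t F"
  have "{e \<in> F. \<not> crossed_by_structured L P s t e} \<subseteq> broken_segments G F \<union> poor"
    using rich_segment_crossed_by_structured[OF sys fib] by (auto simp: poor_def)
  then have "card {e \<in> F. \<not> crossed_by_structured L P s t e} \<le> card (broken_segments G F \<union> poor)"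
    using segment_systemD(6)[OF sys] by (intro card_mono) (auto simp: poor_def finite_broken_segments)
  also have "\<dots> \<le> card (broken_segments G F) + card poor" by (rule card_Un_le)
  also have "card poor \<le> 4 * \<sigma> * card P"
    unfolding poor_def by (rule card_poor_segments_le[OF sys fib assms(4,5)])
  finally have "q * s * card {e \<in> F. \<not> crossed_by_structured L P s t e} \<le>
      q * s * (card (broken_segments G F) + 4 * \<sigma> * card P)" by simp
  also have "\<dots> = q * s * card (broken_segments G F) + 4 * q * s * \<sigma> * card P"
    by (simp add: algebra_simps)
  also have "q * s * card (broken_segments G F) \<le> s * (2 * (card L)\<^sup>2) + q\<^sup>2 * card P"
    using br sum_crossing_number_le[OF sys] by (meson add_right_mono mult_le_mono2 order_trans)
  finally show ?thesis by simp
qed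

end

section \<open>Extremal configurations\<close>

context coordinates
begin

definition structured_segments :: "'l set \<Rightarrow> 'p set \<Rightarrow> ('l \<times> 'p) set \<Rightarrow> nat \<Rightarrow> nat \<Rightarrow> 'l \<Rightarrow> ('l \<times> 'p \<times> 'p) set" where
  "structured_segments L P J s t l = {e \<in> consecutive J. fst e = l \<and> crossed_by_structured L P s t e}"

lemma card_incidences_eq_sum:
  assumes "finite J" "finite A"
  shows "card {x \<in> J. fst x \<in> A} = (\<Sum>l\<in>A. card {p. (l, p) \<in> J})"
proof -
  have "{x \<in> J. fst x \<in> A} = (SIGMA l:A. {p. (l, p) \<in> J})" by auto
  moreover have "finite {p. (l, p) \<in> J}" for l
    by (rule finite_subset[of _ "snd ` J"]) (use assms in force)+
  ultimately show ?thesis using assms(2) by simp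
qed

lemma card_segments_eq_sum:
  fixes F :: "('l \<times> 'p \<times> 'p) set"
  assumes "finite F" "finite A"
  shows "card {e \<in> F. fst e \<in> A} = (\<Sum>l\<in>A. card {e \<in> F. fst e = l})"
proof -
  have "{e \<in> F. fst e \<in> A} = (\<Union>l\<in>A. {e \<in> F. fst e = l})" by auto
  moreover have "card (\<Union>l\<in>A. {e \<in> F. fst e = l}) = (\<Sum>l\<in>A. card {e \<in> F. fst e = l})"
    using assms by (intro card_UN_disjoint) auto
  ultimately show ?thesis by simp
qed

end

lemma nat_ceiling_bounds:
  fixes x :: real
  assumes "1 \<le> x"
  shows "x \<le> real (nat \<lceil>x\<rceil>)" "real (nat \<lceil>x\<rceil>) \<le> 2 * x"
  using assms by linarith+

lemma nat_floor_bounds: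
  fixes x :: real
  assumes "1 \<le> x"
  shows "x / 2 \<le> real (nat \<lfloor>x\<rfloor>)" "real (nat \<lfloor>x\<rfloor>) \<le> x"
proof -
  show "x / 2 \<le> real (nat \<lfloor>x\<rfloor>)"
  proof (cases "x \<le> 2")
    case True
    have "1 \<le> \<lfloor>x\<rfloor>" using assms by simp
    then have "1 \<le> real (nat \<lfloor>x\<rfloor>)" by simp
    then show ?thesis using True by simp
  qed linarith
  show "real (nat \<lfloor>x\<rfloor>) \<le> x" using assms by simp
qed

text \<open>Here \<open>u\<close> stands for \<open>N\<^sup>1\<^sup>/\<^sup>3\<close> and \<open>v\<close> for a small power of \<open>N\<close>.\<close>

locale coordinate_configuration = coordinates X Y slope icpt
  for X Y :: "'p \<Rightarrow> real" and slope icpt :: "'l \<Rightarrow> real" +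
  fixes L :: "'l set" and P :: "'p set" and J :: "('l \<times> 'p) set" and u v :: real
  assumes finL: "finite L" and finP: "finite P"
    and injX: "inj_on X P" and injL: "inj_on (\<lambda>l. (slope l, icpt l)) L"
    and J: "J \<subseteq> {(l, p) \<in> L \<times> P. on_line l p}"
    and cardL: "real (card L) \<le> u ^ 3" and cardP: "real (card P) \<le> u ^ 3"
    and v: "1 \<le> v" and u: "4 * v ^ 4 \<le> u"
    and cardJ: "100 * (u ^ 4 / v) \<le> real (card J)"
begin

text \<open>Rounding goes down for \<open>s\<close> and up for \<open>t\<close>, so that a group has
  at most \<open>u * v\<^sup>2\<close> points and a structured set at least
  \<open>u\<^sup>2 / v\<^sup>2\<close> lines, exactly as the final exponents demand.\<close>

definition s where "s = nat \<lfloor>u * v\<^sup>2\<rfloor>"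
definition t where "t = nat \<lceil>u\<^sup>2 / v\<^sup>2\<rceil>"
definition good where "good l = structured_segments L P J s t l"
definition L' where "L' = {l \<in> L. u / v \<le> real (card (good l))}"
definition J' where "J' = {x \<in> J. fst x \<in> L'}"
text \<open>The unit in which incidences are measured: \<open>J\<close> has at least 100 units, and
  the errors below are small multiples of \<open>W\<close>.\<close>

definition W where "W = u ^ 4 / v"
definition poor where "poor = {e \<in> consecutive J. \<not> crossed_by_structured L P s t e}"

lemma sys: "segment_system L P (consecutive J)"
  by (rule segment_system_consecutive[OF finL finP injX injL J])

lemma finJ: "finite J"
proof (rule finite_subset)
  show "J \<subseteq> L \<times> P" using J by auto
qed (use finL finP in auto)

lemma injJ: "inj_on X (snd ` J)"
  using injX by (rule inj_on_subset) (use J in auto)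

lemma v_powers: "v \<le> v ^ 4" "v\<^sup>2 \<le> v ^ 4"
  using v power_increasing[of 1 4 v] power_increasing[of 2 4 v] by auto

lemma u_bounds: "4 * v \<le> u" "4 * v\<^sup>2 \<le> u" "4 \<le> u" "0 < u"
  using u v v_powers by linarith+

lemma W_pos: "0 < W" and cube_le_W: "u ^ 3 \<le> W" and quotient_ge: "1 \<le> u / v"
proof -
  show "0 < W" using u_bounds v by (simp add: W_def)
  show "1 \<le> u / v" using u_bounds v by (simp add: le_divide_eq)
  then have "u ^ 3 * 1 \<le> u ^ 3 * (u / v)" using u_bounds by (intro mult_left_mono) auto
  then show "u ^ 3 \<le> W" by (simp add: W_def power3_eq_cube power4_eq_xxxx)
qed

lemma s_bounds: "u * v\<^sup>2 / 2 \<le> real s" "real s \<le> u * v\<^sup>2" "0 < s"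
proof -
  have "1 * 1 \<le> u * v\<^sup>2" using u_bounds v by (intro mult_mono) auto
  then show "u * v\<^sup>2 / 2 \<le> real s" "real s \<le> u * v\<^sup>2" "0 < s"
    unfolding s_def using nat_floor_bounds[of "u * v\<^sup>2"] by auto
qed

lemma t_bounds: "u\<^sup>2 / v\<^sup>2 \<le> real t" "real t \<le> 2 * (u\<^sup>2 / v\<^sup>2)"
proof -
  have "1 \<le> (u / v)\<^sup>2" using quotient_ge by simp
  then show "u\<^sup>2 / v\<^sup>2 \<le> real t" "real t \<le> 2 * (u\<^sup>2 / v\<^sup>2)"
    unfolding t_def using nat_ceiling_bounds[of "u\<^sup>2 / v\<^sup>2"] by (auto simp: power_divide)
qed

text \<open>With \<open>q\<close> about \<open>u\<^sup>2 * v\<close> and \<open>\<sigma>\<close>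
  about \<open>3 * (u / v)\<close>, the three error terms are at most 2, 4 and 16 times
  \<open>W\<close>.\<close>

lemma card_poor_le: "real (card poor) \<le> 22 * W"
proof -
  define q where "q = nat \<lceil>u\<^sup>2 * v\<rceil>"
  \<comment> \<open>The square of \<open>\<sigma>\<close> must reach \<open>2 * (t + 2 * s)\<close>.
    The part from \<open>t\<close> is at most four times \<open>u\<^sup>2 / v\<^sup>2\<close>, and
    \<open>4 * v ^ 4 \<le> u\<close> keeps the part from \<open>s\<close> below one more such term,
    so the factor 3 is enough.\<close>
  define \<sigma> where "\<sigma> = nat \<lceil>3 * (u / v)\<rceil>"
  have "1 * 1 \<le> u\<^sup>2 * v" using u_bounds v by (intro mult_mono) auto
  then have q: "u\<^sup>2 * v \<le> real q" "real q \<le> 2 * (u\<^sup>2 * v)" "0 < q"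
    unfolding q_def using nat_ceiling_bounds[of "u\<^sup>2 * v"] by auto
  have \<sigma>: "3 * (u / v) \<le> real \<sigma>" "real \<sigma> \<le> 4 * (u / v)" "0 < \<sigma>"
    unfolding \<sigma>_def using quotient_ge by linarith+
  have "4 * (u * v\<^sup>2) \<le> u\<^sup>2 / v\<^sup>2"
  proof -
    have "u * (4 * v ^ 4) \<le> u * u" using u u_bounds by (intro mult_left_mono) auto
    then show ?thesis using v by (simp add: le_divide_eq power2_eq_square power4_eq_xxxx mult_ac)
  qed
  then have "2 * (real t + 2 * real s) \<le> 9 * (u\<^sup>2 / v\<^sup>2)"
    using t_bounds(2) s_bounds(2) zero_le_divide_iff[of "u\<^sup>2" "v\<^sup>2"] by simp
  also have "\<dots> = (3 * (u / v))\<^sup>2" by (simp add: power_divide power_mult_distrib)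
  also have "\<dots> \<le> (real \<sigma>)\<^sup>2" using \<sigma>(1) quotient_ge by (intro power_mono) auto
  finally have "real (2 * (t + 2 * s)) \<le> real (\<sigma>\<^sup>2)" by simp
  then have "2 * (t + 2 * s) \<le> \<sigma>\<^sup>2" by linarith
  from most_segments_crossed_by_structured[OF sys q(3) s_bounds(3) \<sigma>(3) this]
  have "real (q * s * card poor) \<le> real (2 * s * (card L)\<^sup>2 + q\<^sup>2 * card P + 4 * q * s * \<sigma> * card P)"
    unfolding poor_def by (rule of_nat_mono)
  then have "real q * real s * real (card poor) \<le>
      2 * real s * (real (card L))\<^sup>2 + (real q)\<^sup>2 * real (card P) + 4 * real q * real s * real \<sigma> * real (card P)"
    by simp
  also have "2 * real s * (real (card L))\<^sup>2 \<le> 2 * real s * (real q * W)"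
  proof -
    have "(real (card L))\<^sup>2 \<le> (u ^ 3)\<^sup>2" using cardL by (intro power_mono) auto
    also have "(u ^ 3)\<^sup>2 = (u\<^sup>2 * v) * W"
      using v by (simp add: W_def power2_eq_square power3_eq_cube power4_eq_xxxx)
    also have "\<dots> \<le> real q * W" using q(1) W_pos by (intro mult_right_mono) auto
    finally show ?thesis by (intro mult_left_mono) auto
  qed
  also have "(real q)\<^sup>2 * real (card P) \<le> real q * (4 * real s * W)"
  proof -
    have "real q * real (card P) \<le> 2 * (u\<^sup>2 * v) * u ^ 3" using q(2) cardP u_bounds v by (intro mult_mono) auto
    also have "\<dots> = 4 * (u * v\<^sup>2 / 2) * W"
      using v by (simp add: W_def power2_eq_square power3_eq_cube power4_eq_xxxx)
    also have "\<dots> \<le> 4 * real s * W" using s_bounds(1) W_pos by (intro mult_right_mono mult_left_mono) auto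
    finally have "real q * (real q * real (card P)) \<le> real q * (4 * real s * W)" by (intro mult_left_mono) auto
    then show ?thesis by (simp add: power2_eq_square mult.assoc)
  qed
  also have "4 * real q * real s * real \<sigma> * real (card P) \<le> 4 * real q * real s * (4 * W)"
  proof -
    have "real \<sigma> * real (card P) \<le> 4 * (u / v) * u ^ 3" using \<sigma>(2) cardP u_bounds v by (intro mult_mono) auto
    also have "\<dots> = 4 * W" by (simp add: W_def power3_eq_cube power4_eq_xxxx)
    finally have "4 * real q * real s * (real \<sigma> * real (card P)) \<le> 4 * real q * real s * (4 * W)"
      by (intro mult_left_mono) auto
    then show ?thesis by (simp add: mult.assoc)
  qed
  finally have "(real q * real s) * real (card poor) \<le> (real q * real s) * (22 * W)"
    by (simp add: algebra_simps)
  then show ?thesis using q(3) s_bounds(3) by (simp add: mult_le_cancel_left)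
qed

text \<open>Every consecutive segment on \<open>l\<close> is good or poor; the \<open>+ 1\<close> is
  the rightmost incidence.\<close>

lemma card_incidences_on_line_le:
  "card {p. (l, p) \<in> J} \<le> card (good l) + card {e \<in> poor. fst e = l} + 1"
proof -
  note finF = segment_systemD(6)[OF sys]
  have "{e \<in> consecutive J. fst e = l} \<subseteq> good l \<union> {e \<in> poor. fst e = l}"
    by (auto simp: good_def structured_segments_def poor_def)
  moreover have "finite (good l \<union> {e \<in> poor. fst e = l})"
    by (rule finite_subset[OF _ finF]) (auto simp: good_def structured_segments_def poor_def)
  ultimately have "card {e \<in> consecutive J. fst e = l} \<le> card (good l \<union> {e \<in> poor. fst e = l})"
    by (intro card_mono)
  also have "\<dots> \<le> card (good l) + card {e \<in> poor. fst e = l}" by (rule card_Un_le)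
  finally show ?thesis using card_incidences_le_consecutive[OF finJ injJ, of l] by simp
qed

lemma finite_poor: "finite poor"
  using segment_systemD(6)[OF sys] by (simp add: poor_def)

lemma sum_poor_le:
  assumes "A \<subseteq> L"
  shows "(\<Sum>l\<in>A. card {e \<in> poor. fst e = l}) \<le> card poor"
proof -
  have "finite A" using assms finL finite_subset by blast
  from card_segments_eq_sum[OF finite_poor this] show ?thesis
    using card_mono[OF finite_poor, of "{e \<in> poor. fst e \<in> A}"] by auto
qed

text \<open>The lines outside \<open>L'\<close> lose little: fewer than \<open>u / v\<close> good
  segments on each of at most \<open>u ^ 3\<close> lines give at most \<open>W\<close>, poor
  segments \<open>22 * W\<close>, and one further incidence per line again \<open>W\<close>. This is
  less than a quarter of \<open>card J\<close>.\<close>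

lemma card_J_le: "real (card J) \<le> 2 * real (card J')"
proof -
  have fin: "finite (L - L')" using finL by simp
  have "J \<subseteq> J' \<union> {x \<in> J. fst x \<in> L - L'}" using J by (auto simp: J'_def)
  moreover have "finite (J' \<union> {x \<in> J. fst x \<in> L - L'})" using finJ by (simp add: J'_def)
  ultimately have "card J \<le> card (J' \<union> {x \<in> J. fst x \<in> L - L'})" by (intro card_mono)
  also have "\<dots> \<le> card J' + card {x \<in> J. fst x \<in> L - L'}" by (rule card_Un_le)
  finally have 1: "real (card J) \<le> real (card J') + real (card {x \<in> J. fst x \<in> L - L'})" by linarith
  have "card {x \<in> J. fst x \<in> L - L'} = (\<Sum>l\<in>L - L'. card {p. (l, p) \<in> J})"
    by (rule card_incidences_eq_sum[OF finJ fin])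
  also have "\<dots> \<le> (\<Sum>l\<in>L - L'. card (good l) + card {e \<in> poor. fst e = l} + 1)"
    by (intro sum_mono card_incidences_on_line_le)
  also have "\<dots> = (\<Sum>l\<in>L - L'. card (good l)) + (\<Sum>l\<in>L - L'. card {e \<in> poor. fst e = l}) + card (L - L')"
    by (simp only: sum.distrib sum_constant) simp
  finally have "real (card {x \<in> J. fst x \<in> L - L'}) \<le> real (\<Sum>l\<in>L - L'. card (good l)) +
      real (\<Sum>l\<in>L - L'. card {e \<in> poor. fst e = l}) + real (card (L - L'))"
    by linarith
  moreover have "real (\<Sum>l\<in>L - L'. card (good l)) \<le> W"
  proof -
    have "real (\<Sum>l\<in>L - L'. card (good l)) = (\<Sum>l\<in>L - L'. real (card (good l)))" by simp
    also have "\<dots> \<le> real (card (L - L')) * (u / v)"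
      by (rule sum_bounded_above) (auto simp: L'_def)
    also have "\<dots> \<le> u ^ 3 * (u / v)"
      using card_mono[OF finL, of "L - L'"] cardL quotient_ge by (intro mult_right_mono) auto
    finally show ?thesis by (simp add: W_def power3_eq_cube power4_eq_xxxx)
  qed
  moreover have "real (\<Sum>l\<in>L - L'. card {e \<in> poor. fst e = l}) \<le> 22 * W"
    using sum_poor_le[of "L - L'"] card_poor_le by (meson Diff_subset of_nat_mono order_trans)
  moreover have "real (card (L - L')) \<le> W"
    using card_mono[OF finL, of "L - L'"] cardL cube_le_W by auto
  ultimately show ?thesis using 1 cardJ W_pos unfolding W_def[symmetric] by linarith
qed

text \<open>Too few lines cannot carry half of the incidences: if \<open>L'\<close> were smaller,
  \<open>segment_count_bound\<close> with groups of about \<open>u / v\<close> points would allow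
  only \<open>6 * W\<close> consecutive segments of \<open>J'\<close>.\<close>

lemma card_L'_ge: "u ^ 3 / v\<^sup>2 \<le> real (card L')"
proof (rule ccontr)
  assume small: "\<not> ?thesis"
  define \<sigma> where "\<sigma> = nat \<lceil>u / v\<rceil>"
  have \<sigma>: "u / v \<le> real \<sigma>" "real \<sigma> \<le> 2 * (u / v)" "0 < \<sigma>"
    unfolding \<sigma>_def using nat_ceiling_bounds[OF quotient_ge] quotient_ge by auto
  have L'L: "L' \<subseteq> L" and finL': "finite L'" using finL by (auto simp: L'_def)
  define F where "F = consecutive J'"
  have sys': "segment_system L' P F" unfolding F_def
    by (rule segment_system_consecutive)
       (use finL' finP injX injL L'L J in \<open>auto simp: J'_def intro: inj_on_subset\<close>)
  have finJ': "finite J'" using finJ by (simp add: J'_def)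
  have "card J' = (\<Sum>l\<in>L'. card {p. (l, p) \<in> J'})"
    using card_incidences_eq_sum[OF finJ' finL'] by (simp add: J'_def)
  also have "\<dots> \<le> (\<Sum>l\<in>L'. card {e \<in> F. fst e = l} + 1)"
    unfolding F_def using finJ' injJ
    by (intro sum_mono card_incidences_le_consecutive) (auto simp: J'_def intro: inj_on_subset)
  also have "\<dots> = card {e \<in> F. fst e \<in> L'} + card L'"
    using card_segments_eq_sum[OF segment_systemD(6)[OF sys'] finL']
    by (simp only: sum.distrib sum_constant) simp
  also have "\<dots> \<le> card F + card L'"
    using segment_systemD(6)[OF sys'] by (intro add_right_mono card_mono) auto
  finally have "real (card J') \<le> real (card F) + real (card L')" by linarith
  moreover have "real (card L') \<le> W"
    using card_mono[OF finL L'L] cardL cube_le_W by linarith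
  \<comment> \<open>\<open>J'\<close> has at least \<open>50 * W\<close> pairs, and passing to
    segments costs one per line, at most \<open>W\<close> in all.\<close>
  ultimately have F_ge: "49 * W \<le> real (card F)"
    using card_J_le cardJ unfolding W_def[symmetric] by linarith
  have "\<sigma>\<^sup>2 * card F \<le> 2 * (card L')\<^sup>2 + 2 * \<sigma> ^ 3 * card P"
    using segment_count_bound[OF sys' \<sigma>(3)] sum_crossing_number_le[OF sys'] by linarith
  then have "real (\<sigma>\<^sup>2 * card F) \<le> real (2 * (card L')\<^sup>2 + 2 * \<sigma> ^ 3 * card P)" by (rule of_nat_mono)
  then have "(real \<sigma>)\<^sup>2 * real (card F) \<le> 2 * (real (card L'))\<^sup>2 + 2 * real \<sigma> ^ 3 * real (card P)" by simp
  also have "(real (card L'))\<^sup>2 \<le> (real \<sigma>)\<^sup>2 * W"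
  proof -
    have "(real (card L'))\<^sup>2 \<le> (u ^ 3 / v\<^sup>2)\<^sup>2" using small by (intro power_mono) auto
    also have "\<dots> = (u / v)\<^sup>2 * (W / v)"
      by (simp add: W_def power2_eq_square power3_eq_cube power4_eq_xxxx)
    also have "\<dots> \<le> (real \<sigma>)\<^sup>2 * W"
    proof (intro mult_mono power_mono)
      show "W / v \<le> W" using W_pos v by (simp add: divide_le_eq)
    qed (use \<sigma> quotient_ge W_pos v in auto)
    finally show ?thesis .
  qed
  also have "2 * real \<sigma> ^ 3 * real (card P) \<le> (real \<sigma>)\<^sup>2 * (4 * W)"
  proof -
    have "2 * real \<sigma> ^ 3 * real (card P) = (real \<sigma>)\<^sup>2 * (2 * (real \<sigma> * real (card P)))"
      by (simp add: power2_eq_square power3_eq_cube)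
    also have "real \<sigma> * real (card P) \<le> 2 * (u / v) * u ^ 3"
      using \<sigma> cardP quotient_ge u_bounds by (intro mult_mono) auto
    also have "2 * (u / v) * u ^ 3 = 2 * W" by (simp add: W_def power3_eq_cube power4_eq_xxxx)
    finally show ?thesis by (simp add: mult_left_mono)
  qed
  finally have "(real \<sigma>)\<^sup>2 * real (card F) \<le> (real \<sigma>)\<^sup>2 * (6 * W)" by (simp add: algebra_simps)
  then have "real (card F) \<le> 6 * W" using \<sigma>(3) by (simp add: mult_le_cancel_left)
  then show False using F_ge W_pos by linarith
qed

text \<open>This serves the case of mostly rich lines, where \<open>L'\<close> must contain a
  positive proportion of all lines. A rich line outside \<open>L'\<close> has fewer than
  \<open>u / v\<close> good segments, so at least half of \<open>\<rho>\<close> is made up of poor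
  ones, of which there are at most \<open>22 * W\<close> in total.\<close>

lemma card_rich_lines_outside_le:
  assumes "R \<subseteq> L" "\<And>l. l \<in> R \<Longrightarrow> \<rho> \<le> real (card {p. (l, p) \<in> J})" "4 * (u / v) \<le> \<rho>"
  shows "real (card (R - L')) * \<rho> \<le> 44 * W"
proof -
  have "\<rho> / 2 \<le> real (card {e \<in> poor. fst e = l})" if "l \<in> R - L'" for l
  proof -
    have "real (card (good l)) < u / v" using that assms(1) by (auto simp: L'_def)
    moreover have "\<rho> \<le> real (card (good l)) + real (card {e \<in> poor. fst e = l}) + 1"
      using assms(2)[of l] that of_nat_mono[OF card_incidences_on_line_le[of l], where 'a = real] by simp
    ultimately show ?thesis using assms(3) quotient_ge by linarith
  qed
  then have "real (card (R - L')) * (\<rho> / 2) \<le> (\<Sum>l\<in>R - L'. real (card {e \<in> poor. fst e = l}))"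
    by (intro sum_bounded_below) auto
  also have "\<dots> = real (\<Sum>l\<in>R - L'. card {e \<in> poor. fst e = l})" by simp
  also have "\<dots> \<le> 22 * W"
    using sum_poor_le[of "R - L'"] assms(1) card_poor_le by (meson Diff_subset of_nat_mono order_trans)
  finally show ?thesis by simp
qed

end

section \<open>From the plane to coordinates\<close>

lemma is_line_param:
  assumes "is_line l"
  obtains a v where "v \<noteq> 0" "l = range (\<lambda>s::real. a + s *\<^sub>R v)"
proof -
  have l: "affine l" "aff_dim l = 1" using assms by (auto simp: is_line_def)
  obtain B where B: "affine hull B = affine hull l" "of_nat (card B) = aff_dim l + 1"
    using aff_dim_basis_exists by metis
  then have "card B = 2" using l by simp
  then obtain a b where ab: "B = {a, b}" "a \<noteq> b" by (auto simp: card_2_iff)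
  have "l = affine hull {a, b}" using B ab l by (simp add: affine_hull_eq[THEN iffD2])
  also have "\<dots> = range (\<lambda>s. a + s *\<^sub>R (b - a))"
  proof
    show "affine hull {a, b} \<subseteq> range (\<lambda>s. a + s *\<^sub>R (b - a))"
    proof
      fix x assume "x \<in> affine hull {a, b}"
      then obtain \<alpha> \<beta> where "x = \<alpha> *\<^sub>R a + \<beta> *\<^sub>R b" "\<alpha> + \<beta> = 1" by (auto simp: affine_hull_2)
      moreover from this have "\<alpha> = 1 - \<beta>" by simp
      ultimately have "x = a + \<beta> *\<^sub>R (b - a)" by (simp add: algebra_simps)
      then show "x \<in> range (\<lambda>s. a + s *\<^sub>R (b - a))" by blast
    qed
    show "range (\<lambda>s. a + s *\<^sub>R (b - a)) \<subseteq> affine hull {a, b}"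
    proof
      fix x assume "x \<in> range (\<lambda>s. a + s *\<^sub>R (b - a))"
      then obtain s where "x = a + s *\<^sub>R (b - a)" by blast
      then have "x = (1 - s) *\<^sub>R a + s *\<^sub>R b" by (simp add: algebra_simps)
      moreover have "(1 - s) + s = 1" by simp
      ultimately show "x \<in> affine hull {a, b}" unfolding affine_hull_2 by blast
    qed
  qed
  finally show ?thesis using that[of "b - a" a] ab by simp
qed

text \<open>Each nonzero vector excludes at most one value of \<open>\<tau>\<close>.\<close>

lemma generic_shear:
  fixes V :: "(real ^ 2) set"
  assumes "finite V" "0 \<notin> V"
  obtains \<tau> where "\<And>v. v \<in> V \<Longrightarrow> v $ 1 + \<tau> * v $ 2 \<noteq> 0"
proof -
  have "finite {\<tau>. v $ 1 + \<tau> * v $ 2 = 0}" if "v \<in> V" for v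
  proof (cases "v $ 2 = 0")
    case True
    have "v \<noteq> 0" using that assms(2) by auto
    then have "v $ 1 \<noteq> 0" using True by (auto simp: vec_eq_iff forall_2)
    then show ?thesis using True by simp
  next
    case False
    then have "{\<tau>. v $ 1 + \<tau> * v $ 2 = 0} \<subseteq> {- v $ 1 / v $ 2}"
      by (auto simp: field_simps)
    then show ?thesis using finite_subset by blast
  qed
  then have "finite (\<Union>v\<in>V. {\<tau>. v $ 1 + \<tau> * v $ 2 = 0})" using assms(1) by blast
  then obtain \<tau> where "\<tau> \<notin> (\<Union>v\<in>V. {\<tau>. v $ 1 + \<tau> * v $ 2 = 0})"
    using ex_new_if_finite infinite_UNIV_char_0 by blast
  then show ?thesis using that[of \<tau>] by blast
qed

text \<open>A generic shear makes the abscissae of the points distinct and no line vertical.\<close>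

definition shear :: "real \<Rightarrow> point \<Rightarrow> real" where
  "shear \<tau> p = p $ 1 + \<tau> * p $ 2"

lemma shear_add_scaleR: "shear \<tau> (p + s *\<^sub>R w) = shear \<tau> p + s * shear \<tau> w"
  by (simp add: shear_def algebra_simps)

lemma shear_eqD: "shear \<tau> p = shear \<tau> r \<Longrightarrow> p $ 2 = r $ 2 \<Longrightarrow> p = r"
  by (simp add: shear_def vec_eq_iff forall_2)

lemma generic_coordinates:
  assumes "finite \<L>" "finite \<P>" "\<forall>l\<in>\<L>. is_line l"
  obtains \<tau> slope icpt where "inj_on (shear \<tau>) \<P>"
    "\<And>l p. l \<in> \<L> \<Longrightarrow> p \<in> l \<longleftrightarrow> p $ 2 = slope l * shear \<tau> p + icpt l"
    "\<And>l. l \<in> \<L> \<Longrightarrow> \<exists>a v. 0 < shear \<tau> v \<and> l = range (\<lambda>s. a + s *\<^sub>R v)"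
proof -
  have "\<exists>a v. v \<noteq> 0 \<and> l = range (\<lambda>s::real. a + s *\<^sub>R v)" if "l \<in> \<L>" for l
    using is_line_param assms(3) that by metis
  then obtain a v where av: "\<And>l. l \<in> \<L> \<Longrightarrow> v l \<noteq> 0 \<and> l = range (\<lambda>s::real. a l + s *\<^sub>R v l)"
    by metis
  \<comment> \<open>Avoiding the directions in \<open>V\<close> makes no line vertical; avoiding the
    differences makes the abscissae of the points distinct.\<close>
  define V where "V = v ` \<L> \<union> ((\<lambda>(p, r). p - r) ` (\<P> \<times> \<P>) - {0})"
  have "finite V" "0 \<notin> V" using assms av by (auto simp: V_def)
  then obtain \<tau> where \<tau>: "\<And>w. w \<in> V \<Longrightarrow> w $ 1 + \<tau> * w $ 2 \<noteq> 0" by (rule generic_shear) blast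
  have v: "shear \<tau> (v l) \<noteq> 0" if "l \<in> \<L>" for l
    using \<tau> that by (auto simp: shear_def V_def)
  define slope where "slope l = v l $ 2 / shear \<tau> (v l)" for l
  define icpt where "icpt l = a l $ 2 - slope l * shear \<tau> (a l)" for l
  show ?thesis
  proof (rule that)
    show "inj_on (shear \<tau>) \<P>"
    proof (rule inj_onI)
      fix p r assume pr: "p \<in> \<P>" "r \<in> \<P>" "shear \<tau> p = shear \<tau> r"
      have "(p - r) $ 1 + \<tau> * (p - r) $ 2 = 0" using pr(3) by (simp add: shear_def algebra_simps)
      then have "p - r \<notin> V" using \<tau> by blast
      then show "p = r" using pr by (auto simp: V_def)
    qed
    fix l assume l: "l \<in> \<L>"
    show "p \<in> l \<longleftrightarrow> p $ 2 = slope l * shear \<tau> p + icpt l" for p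
    proof
      assume "p \<in> l"
      then obtain s where "p = a l + s *\<^sub>R v l" using av l by blast
      then show "p $ 2 = slope l * shear \<tau> p + icpt l"
        using v[OF l] by (simp add: shear_add_scaleR icpt_def slope_def field_simps)
    next
      assume p: "p $ 2 = slope l * shear \<tau> p + icpt l"
      define s where "s = (shear \<tau> p - shear \<tau> (a l)) / shear \<tau> (v l)"
      have "p = a l + s *\<^sub>R v l"
      proof (rule shear_eqD)
        show "shear \<tau> p = shear \<tau> (a l + s *\<^sub>R v l)"
          using v[OF l] by (simp add: shear_add_scaleR s_def)
        show "p $ 2 = (a l + s *\<^sub>R v l) $ 2"
          using p v[OF l] by (simp add: s_def icpt_def slope_def field_simps)
      qed
      then show "p \<in> l" using av l by blast
    qed
    \<comment> \<open>A direction pointing to the left is reversed, so that position along the line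
      increases with the abscissa.\<close>
    show "\<exists>a v. 0 < shear \<tau> v \<and> l = range (\<lambda>s. a + s *\<^sub>R v)"
    proof (cases "0 < shear \<tau> (v l)")
      case True
      then show ?thesis using av[OF l] by blast
    next
      case False
      have "0 < shear \<tau> (- v l)" using False v[OF l] by (simp add: shear_def)
      moreover have "l = range (\<lambda>s. a l + s *\<^sub>R (- v l))"
      proof -
        have "a l + s *\<^sub>R v l = a l + (- s) *\<^sub>R (- v l)" "a l + s *\<^sub>R (- v l) = a l + (- s) *\<^sub>R v l" for s
          by simp_all
        then have "range (\<lambda>s. a l + s *\<^sub>R (- v l)) = range (\<lambda>s. a l + s *\<^sub>R v l)" by blast
        then show ?thesis using av[OF l] by simp
      qed
      ultimately show ?thesis by blast
    qed
  qed
qed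

section \<open>Points and structured sets along a line of the plane\<close>

locale planar_configuration = coordinate_configuration "shear \<tau>" "\<lambda>p. p $ 2" slope icpt \<L> \<P> \<J> u v
  for \<tau> slope icpt and \<L> :: "point set set" and \<P> :: "point set" and \<J> u v +
  assumes mem_line: "l \<in> \<L> \<Longrightarrow> p \<in> l \<longleftrightarrow> on_line l p"
    and line_param: "l \<in> \<L> \<Longrightarrow> \<exists>a w. 0 < shear \<tau> w \<and> l = range (\<lambda>s. a + s *\<^sub>R w)"
begin

text \<open>The point of \<open>l\<close> above the crossing abscissa lies on \<open>m\<close>. Two
  distinct lines cross at one abscissa only, so it is the only common point; since the abscissa is
  affine and increasing along \<open>l\<close>, it lies strictly between \<open>p\<close> and
  \<open>r\<close>.\<close>

lemma crossing_meets_in_open_interval: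
  assumes l: "l \<in> \<L>" and m: "m \<in> crossing_lines \<L> l I" and pr: "p \<in> l" "r \<in> l"
    and I: "I \<subseteq> {shear \<tau> p<..<shear \<tau> r}"
  shows "meets_in_open_interval m l p r"
proof -
  obtain x where x: "m \<in> \<L>" "m \<noteq> l" "x \<in> I" "height m x = height l x"
    using m by (auto simp: crossing_lines_def)
  have xI: "shear \<tau> p < x" "x < shear \<tau> r" using x I by auto
  obtain a w where w: "0 < shear \<tau> w" "l = range (\<lambda>s. a + s *\<^sub>R w)" using line_param[OF l] by blast
  obtain sp sr where s: "p = a + sp *\<^sub>R w" "r = a + sr *\<^sub>R w" using pr w(2) by blast
  define sz where "sz = (x - shear \<tau> a) / shear \<tau> w"
  define z where "z = a + sz *\<^sub>R w"
  have Xz: "shear \<tau> z = x" using w(1) by (simp add: z_def sz_def shear_add_scaleR)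
  have "z \<in> l" unfolding w(2) z_def by (rule rangeI)
  then have "z \<in> m" using mem_line[OF l] mem_line[OF x(1)] x(4) Xz by (simp add: on_line_def)
  have "y = z" if y: "y \<in> m" "y \<in> l" for y
  proof -
    have on: "on_line m y" "on_line l y" using y mem_line[OF l] mem_line[OF x(1)] by auto
    then have "height m (shear \<tau> y) = height l (shear \<tau> y)" by (simp add: on_line_def)
    then have "shear \<tau> y = x" using height_cross_unique[OF injL l x(1)] x(2,4) by metis
    moreover have "z $ 2 = y $ 2"
      using on \<open>z \<in> l\<close> mem_line[OF l, of z] \<open>shear \<tau> y = x\<close> Xz by (simp add: on_line_def)
    ultimately show "y = z" using Xz by (intro shear_eqD[of \<tau>]) auto
  qed
  then have "m \<inter> l = {z}" using \<open>z \<in> l\<close> \<open>z \<in> m\<close> by blast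
  moreover have "z \<in> open_segment p r"
  proof -
    have "shear \<tau> a + sp * shear \<tau> w < shear \<tau> a + sz * shear \<tau> w"
      "shear \<tau> a + sz * shear \<tau> w < shear \<tau> a + sr * shear \<tau> w"
      using xI Xz unfolding s z_def shear_add_scaleR by auto
    then have lt: "sp < sz" "sz < sr" using w(1) by auto
    \<comment> \<open>The ratio in which \<open>z\<close> divides the segment from \<open>p\<close>
      to \<open>r\<close>, as \<open>open_segment\<close> requires.\<close>
    define c where "c = (sz - sp) / (sr - sp)"
    have c: "0 < c" "c < 1" "c * (sr - sp) = sz - sp" using lt by (auto simp: c_def)
    have "z = (1 - c) *\<^sub>R p + c *\<^sub>R r"
    proof -
      have "(1 - c) *\<^sub>R p + c *\<^sub>R r = a + (sp + c * (sr - sp)) *\<^sub>R w"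
        by (simp add: s algebra_simps)
      then show ?thesis by (simp add: c(3) z_def)
    qed
    moreover have "p \<noteq> r" using xI by auto
    ultimately show ?thesis using c unfolding in_segment by blast
  qed
  ultimately show ?thesis unfolding meets_in_open_interval_def by blast
qed

lemma in_order_onI:
  assumes l: "l \<in> \<L>" and p: "\<And>j. j \<in> {1..M} \<Longrightarrow> p j \<in> l"
    and mono: "strict_mono_on {1..M} (\<lambda>j. shear \<tau> (p j))"
  shows "in_order_on l M p"
proof -
  obtain a w where w: "0 < shear \<tau> w" "l = range (\<lambda>s. a + s *\<^sub>R w)" using line_param[OF l] by blast
  define t where "t j = (shear \<tau> (p j) - shear \<tau> a) / shear \<tau> w" for j
  have "w \<noteq> 0" using w(1) by (auto simp: shear_def)
  moreover have "strict_mono_on {1..M} t"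
    using mono w(1) by (auto simp: strict_mono_on_def t_def divide_strict_right_mono)
  moreover have "p j = a + t j *\<^sub>R w" if j: "j \<in> {1..M}" for j
  proof -
    obtain s where "p j = a + s *\<^sub>R w" using p[OF j] w(2) by blast
    moreover from this have "t j = s" using w(1) by (simp add: t_def shear_add_scaleR)
    ultimately show ?thesis by simp
  qed
  ultimately show ?thesis unfolding in_order_on_def using w(2) by blast
qed

text \<open>The points are the left ends of the good segments on \<open>l\<close>, in order. The
  good segment starting at \<open>p j\<close> ends at the next incidence of \<open>\<J>\<close> on
  \<open>l\<close>, hence not beyond \<open>p (Suc j)\<close>, so its structured crossing set also
  meets \<open>l\<close> between these two points.\<close>

lemma structured_points_on_line:
  assumes l: "l \<in> L'"
  obtains M p where "u / v \<le> real M" "in_order_on l M p"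
    "\<And>j. j \<in> {1..M} \<Longrightarrow> p j \<in> \<P> \<and> (l, p j) \<in> J'"
    "\<And>j. j \<in> {1..<M} \<Longrightarrow> \<exists>S Q. S \<subseteq> \<L> \<and> Q \<subseteq> \<P> \<and> u\<^sup>2 / v\<^sup>2 \<le> real (card S) \<and>
        real (card Q) \<le> u * v\<^sup>2 \<and> (\<forall>m\<in>S. \<exists>x\<in>Q. \<exists>y\<in>Q. x \<noteq> y \<and> x \<in> m \<and> y \<in> m) \<and>
        (\<forall>m\<in>S. meets_in_open_interval m l (p j) (p (Suc j)))"
proof -
  define X where "X = shear \<tau>"
  define D where "D = (\<lambda>e. fst (snd e)) ` good l"
  have lL: "l \<in> \<L>" using l by (simp add: L'_def)
  have good: "(l', p, r) \<in> good l \<Longrightarrow> l' = l \<and> (l, p, r) \<in> consecutive \<J> \<and> crossed_by_structured \<L> \<P> s t (l, p, r)"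
    for l' p r by (auto simp: good_def structured_segments_def)
  have DE: "\<exists>r. (l, p, r) \<in> good l" if "p \<in> D" for p
    using that good by (force simp: D_def)
  have "inj_on (\<lambda>e. fst (snd e)) (good l)"
  proof (rule inj_onI)
    fix e e' assume e: "e \<in> good l" "e' \<in> good l" "fst (snd e) = fst (snd e')"
    obtain p r r' where "e = (l, p, r)" "e' = (l, p, r')"
      using e good by (cases e, cases e') auto
    moreover from this have "(l, p, r) \<in> consecutive \<J>" "(l, p, r') \<in> consecutive \<J>"
      using e good by auto
    ultimately show "e = e'"
      using segment_system_disjoint(2)[OF sys, of l p r p r'] segment_system_incidence(6)[OF sys] by auto
  qed
  then have cardD: "card D = card (good l)" by (simp add: D_def card_image)
  have DJ: "(l, p) \<in> \<J> \<and> p \<in> \<P> \<and> p \<in> l" if "p \<in> D" for p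
    using DE[OF that] good J mem_line[OF lL] by (force simp: consecutive_def)
  have "D \<subseteq> \<P>" using DJ by blast
  then have finD: "finite D" and injD: "inj_on X D"
    using finP injX by (auto simp: X_def intro: finite_subset inj_on_subset)
  note bij = bij_betw_rank_in[OF finD injD]
  \<comment> \<open>The points are numbered from 1 while ranks start at 0.\<close>
  define p where "p j = inv_into D (rank_in D X) (j - 1)" for j :: nat
  have p: "p j \<in> D" "rank_in D X (p j) = j - 1" if "j \<in> {1..card D}" for j
  proof -
    have "j - 1 \<in> rank_in D X ` D" using bij that by (auto simp: bij_betw_def)
    then show "p j \<in> D" "rank_in D X (p j) = j - 1"
      unfolding p_def by (auto intro: inv_into_into f_inv_into_f)
  qed
  have less: "X (p i) < X (p j)" if "i \<in> {1..card D}" "j \<in> {1..card D}" "i < j" for i j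
  proof -
    have "rank_in D X (p i) < rank_in D X (p j)" using p(2) that by auto
    then show ?thesis using rank_in_less_iff[OF finD] p(1) that by blast
  qed
  show ?thesis
  proof (rule that)
    show "u / v \<le> real (card D)" using l by (simp add: cardD L'_def)
    show "in_order_on l (card D) p"
      using p(1) DJ less by (intro in_order_onI[OF lL]) (auto simp: strict_mono_on_def X_def)
    show "p j \<in> \<P> \<and> (l, p j) \<in> J'" if "j \<in> {1..card D}" for j
      using DJ[OF p(1)[OF that]] l by (simp add: J'_def)
    fix j assume j: "j \<in> {1..<card D}"
    then have j': "j \<in> {1..card D}" "Suc j \<in> {1..card D}" by auto
    obtain r where "(l, p j, r) \<in> good l" using DE[OF p(1)[OF j'(1)]] by blast
    then have e: "(l, p j, r) \<in> consecutive \<J>" and "crossed_by_structured \<L> \<P> s t (l, p j, r)"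
      using good by auto
    then obtain S Q where SQ: "S \<subseteq> crossing_lines \<L> l {X (p j)<..<X r}" "Q \<subseteq> \<P>" "t \<le> card S" "card Q \<le> s"
      "\<forall>m\<in>S. \<exists>x\<in>Q. \<exists>y\<in>Q. x \<noteq> y \<and> on_line m x \<and> on_line m y"
      unfolding crossed_by_structured_def X_def by auto
    have SL: "S \<subseteq> \<L>" using SQ(1) by (auto simp: crossing_lines_def)
    have "X r \<le> X (p (Suc j))"
      using e less[OF j'] DJ[OF p(1)[OF j'(2)]] by (force simp: consecutive_def X_def)
    then have "meets_in_open_interval m l (p j) (p (Suc j))" if "m \<in> S" for m
      using SQ(1) that DJ[OF p(1)[OF j'(1)]] DJ[OF p(1)[OF j'(2)]]
      by (intro crossing_meets_in_open_interval[OF lL, of m "{X (p j)<..<X r}"]) (auto simp: X_def)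
    moreover have "u\<^sup>2 / v\<^sup>2 \<le> real (card S)" using t_bounds(1) SQ(3) by linarith
    moreover have "real (card Q) \<le> u * v\<^sup>2" using s_bounds(2) SQ(4) by linarith
    moreover have "\<forall>m\<in>S. \<exists>x\<in>Q. \<exists>y\<in>Q. x \<noteq> y \<and> x \<in> m \<and> y \<in> m"
      using SQ(5) SL mem_line by blast
    ultimately show "\<exists>S Q. S \<subseteq> \<L> \<and> Q \<subseteq> \<P> \<and> u\<^sup>2 / v\<^sup>2 \<le> real (card S) \<and>
        real (card Q) \<le> u * v\<^sup>2 \<and> (\<forall>m\<in>S. \<exists>x\<in>Q. \<exists>y\<in>Q. x \<noteq> y \<and> x \<in> m \<and> y \<in> m) \<and>
        (\<forall>m\<in>S. meets_in_open_interval m l (p j) (p (Suc j)))"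
      using SL SQ(2) by blast
  qed
qed

end

section \<open>Choice of exponents\<close>

lemma gtrsim_minusD:
  assumes "gtrsim_minus K C e0 N b x" "1 \<le> N"
  shows "N powr b / N powr (K * e0) \<le> C * x"
proof -
  obtain e where e: "e \<in> {0..K * e0}" "N powr (b - e) \<le> C * x" using assms(1) by (auto simp: gtrsim_minus_def)
  have "N powr (b - K * e0) \<le> N powr (b - e)" using e(1) assms(2) by (intro powr_mono) auto
  then show ?thesis using e(2) by (simp add: powr_diff)
qed

lemma eventually_powr_ge:
  fixes b c :: real
  assumes "0 < b"
  shows "\<forall>\<^sub>F x in at_top. c \<le> x powr b"
  using eventually_ge_at_top[of "max c 1 powr (1 / b)"]
proof eventually_elim
  case (elim x)
  have "c \<le> (max c 1 powr (1 / b)) powr b" using assms by (simp add: powr_powr)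
  also have "\<dots> \<le> x powr b" using elim assms by (intro powr_mono2) auto
  finally show ?case .
qed

text \<open>Names the conclusion for one configuration, so that the quantifiers over the constants
  can be treated without unfolding it.\<close>

definition structured_refinement_exists ::
    "real \<Rightarrow> real \<Rightarrow> real \<Rightarrow> real \<Rightarrow> real \<Rightarrow> real \<Rightarrow>
     point set set \<Rightarrow> point set \<Rightarrow> (point set \<times> point) set \<Rightarrow> bool" where
  "structured_refinement_exists K C K' C' e0 N \<L> \<P> \<J> \<longleftrightarrow>
    (\<exists>\<L>' \<J>'.
       refinement_up_to_poor_lines K' C' e0 N \<L> \<P> \<J> \<L>' \<P> \<J>' \<and>
       (mostly_rich K C e0 N \<L> \<J> \<longrightarrow> refinement C' \<L> \<P> \<J> \<L>' \<P> \<J>') \<and>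
       (\<forall>l\<in>\<L>'. \<exists>(M :: nat) p.
          gtrsim_minus K' C' e0 N (1/3) (real M) \<and>
          in_order_on l M p \<and>
          (\<forall>j\<in>{1..M}. p j \<in> \<P> \<and> (l, p j) \<in> \<J>') \<and>
          (\<forall>j\<in>{1..<M}. \<exists>\<L>\<^sub>j \<subseteq> \<L>. structured K' e0 N \<L>\<^sub>j \<and>
             (\<forall>m\<in>\<L>\<^sub>j. meets_in_open_interval m l (p j) (p (Suc j))))))"

text \<open>The small power \<open>v\<close> is \<open>k\<^sup>2 * w\<close>, where \<open>k\<close>
  is the largest loss in the hypotheses and \<open>w\<close> absorbs constants; two factors
  \<open>k\<close> occur since both the number of lines and their richness may lose one. The
  conclusion loses at most \<open>v\<^sup>2\<close>, and \<open>K' * e0\<close> equals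
  \<open>2 * a\<close>. In \<open>C'\<close> the 2 comes from \<open>card_J_le\<close> and
  \<open>2 * C\<close> from the comparison with the rich lines.\<close>

lemma extremal_partial_configuration_structure:
  fixes K C e0 N :: real
  defines "a \<equiv> (2 * K + 1) * e0" and "K' \<equiv> 4 * K + 2" and "C' \<equiv> max 2 (2 * C)"
  assumes ex: "extremal_partial_configuration K C e0 N \<L> \<P> \<J>"
    and par: "0 \<le> K" "0 < e0" "0 < C" "1 \<le> N"
    and Nv: "4 * (N powr a) ^ 4 \<le> N powr (1/3)" and Nw: "100 * C + 88 * C ^ 3 \<le> N powr e0"
  shows "structured_refinement_exists K C K' C' e0 N \<L> \<P> \<J>"
proof -
  define u where "u = N powr (1/3)"
  define v where "v = N powr a"
  define k where "k = N powr (K * e0)"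
  define w where "w = N powr e0"
  have N: "0 < N" using par by simp
  have v_eq: "v = k\<^sup>2 * w"
    by (simp add: v_def k_def w_def a_def power2_eq_square powr_add[symmetric] algebra_simps)
  have k: "1 \<le> k" and w: "1 \<le> w" using par by (auto simp: k_def w_def ge_one_powr_ge_zero)
  have wC: "100 * C \<le> w" "88 * C ^ 3 \<le> w"
    using Nw par(3) zero_less_power[OF par(3), of 3] unfolding w_def by linarith+
  have u0: "0 < u" using N by (simp add: u_def)
  have a0: "0 \<le> a" and aK: "a \<le> K' * e0" "2 * a \<le> K' * e0" using par by (auto simp: a_def K'_def algebra_simps)
  have v1: "1 \<le> v" using par a0 by (auto simp: v_def ge_one_powr_ge_zero)
  have u3: "u ^ 3 = N" and u4: "u ^ 4 = N powr (4/3)"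
    using N by (simp_all add: u_def powr_power)
  have uv: "u / v = N powr (1/3 - a)" "u\<^sup>2 / v\<^sup>2 = N powr (2/3 - 2 * a)" "u * v\<^sup>2 = N powr (1/3 + 2 * a)"
    "u ^ 3 / v\<^sup>2 = N powr (1 - 2 * a)"
    using N u3 by (simp_all add: u_def v_def powr_diff powr_add powr_power)
  note ex' = ex[unfolded extremal_partial_configuration_def]
  have fin: "finite \<L>" "finite \<P>" and lines: "\<forall>l\<in>\<L>. is_line l"
    and inc: "\<J> \<subseteq> {(l, p) \<in> \<L> \<times> \<P>. p \<in> l}"
    and upper: "real (card \<L>) \<le> N" "real (card \<P>) \<le> N" using ex' by auto
  have Jlow: "u ^ 4 / k \<le> C * real (card \<J>)" and Llow: "u ^ 3 / k \<le> C * real (card \<L>)"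
    using ex' gtrsim_minusD[of K C e0 N "4/3" "real (card \<J>)"] gtrsim_minusD[of K C e0 N 1 "real (card \<L>)"] par(4)
    by (simp_all add: u4 u3 k_def)
  have cardJ: "100 * (u ^ 4 / v) \<le> real (card \<J>)"
  proof -
    have "100 * C * 1 \<le> w * k" using wC(1) k w by (intro mult_mono) auto
    then have "100 * C * (u ^ 4 / v) \<le> w * k * (u ^ 4 / v)" using u0 v1 by (intro mult_right_mono) auto
    also have "\<dots> = u ^ 4 / k" using k w by (simp add: v_eq power2_eq_square field_simps)
    finally have "100 * C * (u ^ 4 / v) \<le> C * real (card \<J>)" using Jlow by linarith
    then have "C * (100 * (u ^ 4 / v)) \<le> C * real (card \<J>)" by (simp only: mult_ac)
    then show ?thesis using par(3) by (rule mult_left_le_imp_le)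
  qed
  obtain \<tau> slope icpt where coords: "inj_on (shear \<tau>) \<P>"
    "\<And>l p. l \<in> \<L> \<Longrightarrow> p \<in> l \<longleftrightarrow> p $ 2 = slope l * shear \<tau> p + icpt l"
    "\<And>l. l \<in> \<L> \<Longrightarrow> \<exists>a v. 0 < shear \<tau> v \<and> l = range (\<lambda>s. a + s *\<^sub>R v)"
    by (rule generic_coordinates[OF fin lines]) blast
  interpret coordinates "shear \<tau>" "\<lambda>p. p $ 2" slope icpt .
  have mem: "p \<in> l \<longleftrightarrow> on_line l p" if "l \<in> \<L>" for l p
    using coords(2)[OF that] by (simp add: on_line_def height_def)
  interpret planar_configuration \<tau> slope icpt \<L> \<P> \<J> u v
  proof
    show "inj_on (\<lambda>l. (slope l, icpt l)) \<L>"
      using coords(2) by (intro inj_onI set_eqI) simp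
    show "\<J> \<subseteq> {(l, p) \<in> \<L> \<times> \<P>. on_line l p}" using inc mem by auto
    show "4 * v ^ 4 \<le> u" using Nv by (simp add: u_def v_def)
  qed (use fin coords upper u3 v1 cardJ mem in auto)
  have L'L: "L' \<subseteq> \<L>" by (auto simp: L'_def)
  have J'J: "J' \<subseteq> \<J>" "J' \<subseteq> L' \<times> \<P>" using inc by (auto simp: J'_def)
  have C': "2 \<le> C'" "2 * C \<le> C'" by (auto simp: C'_def)
  have simJ: "sim C' (real (card J')) (real (card \<J>))"
  proof -
    have "real (card J') \<le> real (card \<J>)" using card_mono[OF finJ J'J(1)] by simp
    also have "\<dots> \<le> C' * real (card \<J>)" using C' by (simp add: mult_le_cancel_right1)
    finally have "real (card J') \<le> C' * real (card \<J>)" .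
    moreover have "2 * real (card J') \<le> C' * real (card J')" using C' by (intro mult_right_mono) auto
    ultimately show ?thesis using card_J_le by (simp add: sim_def)
  qed
  have simP: "sim C' (real (card \<P>)) (real (card \<P>))"
    using C' by (simp add: sim_def mult_le_cancel_right1)
  have "refinement_up_to_poor_lines K' C' e0 N \<L> \<P> \<J> L' \<P> J'"
  proof -
    have "N powr (- (2 * a)) * real (card \<L>) \<le> N powr (- (2 * a)) * N"
      using upper by (intro mult_left_mono) auto
    also have "\<dots> = u ^ 3 / v\<^sup>2" unfolding uv(4) using N by (simp add: powr_diff powr_minus_divide)
    also have "\<dots> \<le> real (card L')" by (rule card_L'_ge)
    also have "\<dots> \<le> C' * real (card L')" using C' by (simp add: mult_le_cancel_right1)
    finally have "\<exists>e\<in>{0..K' * e0}. N powr (- e) * real (card \<L>) \<le> C' * real (card L')"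
      using a0 aK(2) by (intro bexI[of _ "2 * a"]) auto
    then show ?thesis
      unfolding refinement_up_to_poor_lines_def using L'L J'J simP simJ by blast
  qed
  moreover have "refinement C' \<L> \<P> \<J> L' \<P> J'" if rich: "mostly_rich K C e0 N \<L> \<J>"
  proof -
    define R where "R = {l \<in> \<L>. gtrsim_minus K C e0 N (1/3) (card {p. (l, p) \<in> \<J>})}"
    \<comment> \<open>The number of incidences guaranteed on a line of \<open>R\<close> under the
      largest admissible loss.\<close>
    define \<rho> where "\<rho> = u / k / C"
    have R: "R \<subseteq> \<L>" "real (card \<L>) \<le> C * real (card R)" using rich by (auto simp: R_def mostly_rich_def)
    then have finR: "finite R" using fin finite_subset by blast
    have "\<rho> \<le> real (card {p. (l, p) \<in> \<J>})" if "l \<in> R" for l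
    proof -
      have "u / k \<le> C * real (card {p. (l, p) \<in> \<J>})"
        using that gtrsim_minusD[of K C e0 N "1/3"] par(4) by (simp add: R_def u_def k_def)
      then show ?thesis using par(3) by (simp only: \<rho>_def pos_divide_le_eq mult.commute)
    qed
    moreover have "4 * (u / v) \<le> \<rho>"
    proof -
      have "4 * C * 1 \<le> w * k" using wC(1) par(3) k w by (intro mult_mono) auto
      then have "4 * C * (u / v) \<le> w * k * (u / v)" using u0 v1 by (intro mult_right_mono) auto
      also have "\<dots> = u / k" using k w by (simp add: v_eq power2_eq_square field_simps)
      finally show ?thesis using par(3) by (simp only: \<rho>_def pos_le_divide_eq mult_ac)
    qed
    ultimately have "real (card (R - L')) * \<rho> \<le> 44 * W" by (intro card_rich_lines_outside_le R(1))
    moreover have "0 < \<rho>" using u0 k par(3) by (simp add: \<rho>_def)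
    ultimately have out: "real (card (R - L')) \<le> 44 * W / \<rho>" by (simp only: pos_le_divide_eq)
    \<comment> \<open>The constant \<open>88 * C ^ 3\<close> is split off to be bounded by
      \<open>w\<close>. What remains is compared with |R| through the lower bound for the number of
      lines and the assumption that most of them are rich; doubling 44 to 88 leaves the factor one
      half.\<close>
    have "44 * W / \<rho> = (88 * C ^ 3) * (u ^ 3 / (2 * C\<^sup>2 * k * w))"
      unfolding W_def unfolding v_eq \<rho>_def using u0 k w par(3)
      by (simp add: power2_eq_square power3_eq_cube power4_eq_xxxx field_simps)
    also have "\<dots> \<le> w * (u ^ 3 / (2 * C\<^sup>2 * k * w))"
      using u0 k w wC(2) by (intro mult_right_mono) auto
    also have "\<dots> = (u ^ 3 / k) / (2 * C\<^sup>2)" using w by (simp add: field_simps)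
    also have "\<dots> \<le> (C * (C * real (card R))) / (2 * C\<^sup>2)"
      using Llow R(2) par(3) by (intro divide_right_mono) (auto intro: order_trans mult_left_mono)
    also have "\<dots> = real (card R) / 2" using par(3) by (simp add: power2_eq_square)
    finally have "real (card (R - L')) \<le> real (card R) / 2" using out by linarith
    moreover have "card R \<le> card (R - L') + card L'"
    proof -
      have "card R \<le> card ((R - L') \<union> L')"
        using finR fin L'L by (intro card_mono) (auto intro: finite_subset)
      also have "\<dots> \<le> card (R - L') + card L'" by (rule card_Un_le)
      finally show ?thesis .
    qed
    ultimately have "real (card R) \<le> 2 * real (card L')" by linarith
    then have "C * real (card R) \<le> C * (2 * real (card L'))" using par(3) by simp
    also have "\<dots> \<le> C' * real (card L')" using mult_right_mono[OF C'(2), of "real (card L')"] by simp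
    finally have "real (card \<L>) \<le> C' * real (card L')" using R(2) by linarith
    moreover have "real (card L') \<le> C' * real (card \<L>)"
    proof -
      have "real (card L') \<le> real (card \<L>)" using card_mono[OF fin(1) L'L] by simp
      also have "\<dots> \<le> C' * real (card \<L>)" using C' by (simp add: mult_le_cancel_right1)
      finally show ?thesis .
    qed
    ultimately have "sim C' (real (card L')) (real (card \<L>))" by (simp add: sim_def)
    then show ?thesis unfolding refinement_def using L'L J'J simP simJ by blast
  qed
  moreover have "\<exists>(M :: nat) p.
             gtrsim_minus K' C' e0 N (1/3) (real M) \<and>
             in_order_on l M p \<and>
             (\<forall>j\<in>{1..M}. p j \<in> \<P> \<and> (l, p j) \<in> J') \<and>
             (\<forall>j\<in>{1..<M}. \<exists>\<L>\<^sub>j \<subseteq> \<L>. structured K' e0 N \<L>\<^sub>j \<and>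
                (\<forall>m\<in>\<L>\<^sub>j. meets_in_open_interval m l (p j) (p (Suc j))))" if l: "l \<in> L'" for l
  proof -
    obtain M p where M: "u / v \<le> real M" "in_order_on l M p"
      "\<And>j. j \<in> {1..M} \<Longrightarrow> p j \<in> \<P> \<and> (l, p j) \<in> J'"
      and SQ: "\<And>j. j \<in> {1..<M} \<Longrightarrow> \<exists>S Q. S \<subseteq> \<L> \<and> Q \<subseteq> \<P> \<and> u\<^sup>2 / v\<^sup>2 \<le> real (card S) \<and>
        real (card Q) \<le> u * v\<^sup>2 \<and> (\<forall>m\<in>S. \<exists>x\<in>Q. \<exists>y\<in>Q. x \<noteq> y \<and> x \<in> m \<and> y \<in> m) \<and>
        (\<forall>m\<in>S. meets_in_open_interval m l (p j) (p (Suc j)))"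
      by (rule structured_points_on_line[OF l]) blast
    have "N powr (1/3 - a) \<le> C' * real M"
      using M(1) C'(1) mult_right_mono[of 1 C' "real M"] unfolding uv(1) by simp
    then have "gtrsim_minus K' C' e0 N (1/3) (real M)"
      unfolding gtrsim_minus_def using a0 aK(1) by (intro bexI[of _ a]) auto
    moreover have "\<exists>\<L>\<^sub>j \<subseteq> \<L>. structured K' e0 N \<L>\<^sub>j \<and>
        (\<forall>m\<in>\<L>\<^sub>j. meets_in_open_interval m l (p j) (p (Suc j)))" if j: "j \<in> {1..<M}" for j
    proof -
      obtain S Q where S: "S \<subseteq> \<L>" "Q \<subseteq> \<P>" "N powr (2/3 - 2 * a) \<le> real (card S)"
        "real (card Q) \<le> N powr (1/3 + 2 * a)"
        "\<forall>m\<in>S. \<exists>x\<in>Q. \<exists>y\<in>Q. x \<noteq> y \<and> x \<in> m \<and> y \<in> m"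
        "\<forall>m\<in>S. meets_in_open_interval m l (p j) (p (Suc j))"
        using SQ[OF j] unfolding uv by blast
      have "2 * a \<in> {0..K' * e0}" using a0 aK(2) by auto
      moreover have "finite S" "finite Q" using S(1,2) fin finite_subset by blast+
      ultimately have "structured K' e0 N S"
        unfolding structured_def using S lines by blast
      then show ?thesis using S(1,6) by blast
    qed
    ultimately show ?thesis using M(2,3) by blast
  qed
  ultimately show ?thesis unfolding structured_refinement_exists_def by blast
qed

theorem theorem3p13:
  "\<forall>K\<ge>0. \<exists>K'\<ge>0. \<forall>\<^sub>F e0 :: real in at_right 0. \<forall>C>0. \<exists>C'>0. \<forall>\<^sub>F N :: real in at_top.
     \<forall>(\<L> :: point set set) (\<P> :: point set) \<J>.
       extremal_partial_configuration K C e0 N \<L> \<P> \<J> \<longrightarrow>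
       (\<exists>\<L>' \<J>'.
          refinement_up_to_poor_lines K' C' e0 N \<L> \<P> \<J> \<L>' \<P> \<J>' \<and>
          (mostly_rich K C e0 N \<L> \<J> \<longrightarrow> refinement C' \<L> \<P> \<J> \<L>' \<P> \<J>') \<and>
          (\<forall>l\<in>\<L>'. \<exists>(M :: nat) p.
             gtrsim_minus K' C' e0 N (1/3) (real M) \<and>
             in_order_on l M p \<and>
             (\<forall>j\<in>{1..M}. p j \<in> \<P> \<and> (l, p j) \<in> \<J>') \<and>
             (\<forall>j\<in>{1..<M}. \<exists>\<L>\<^sub>j \<subseteq> \<L>. structured K' e0 N \<L>\<^sub>j \<and>
                (\<forall>m\<in>\<L>\<^sub>j. meets_in_open_interval m l (p j) (p (Suc j))))))"
  unfolding structured_refinement_exists_def[symmetric]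
proof (intro allI impI)
  fix K :: real assume K: "0 \<le> K"
  have main: "\<forall>\<^sub>F N in at_top. \<forall>\<L> \<P> \<J>. extremal_partial_configuration K C e0 N \<L> \<P> \<J> \<longrightarrow>
      structured_refinement_exists K C (4 * K + 2) (max 2 (2 * C)) e0 N \<L> \<P> \<J>"
    if e0: "e0 \<in> {0<..<1 / (24 * (2 * K + 1))}" and C: "0 < C" for e0 C :: real
  proof -
    define a where "a = (2 * K + 1) * e0"
    \<comment> \<open>The bound on \<open>e0\<close> makes \<open>1/3 - 4 * a\<close> positive, so
      that \<open>4 * v ^ 4 \<le> u\<close> holds for large \<open>N\<close>.\<close>
    have a: "0 < a" "a < 1/24" using e0 K by (auto simp: a_def less_divide_eq mult_ac)
    have "\<forall>\<^sub>F N :: real in at_top. 1 \<le> N" by (rule eventually_ge_at_top)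
    moreover have "\<forall>\<^sub>F N in at_top. 4 \<le> N powr (1/3 - 4 * a)"
      using a by (intro eventually_powr_ge) auto
    moreover have "\<forall>\<^sub>F N in at_top. 100 * C + 88 * C ^ 3 \<le> N powr e0"
      using e0 by (intro eventually_powr_ge) auto
    ultimately show ?thesis
    proof eventually_elim
      case (elim N)
      have "4 * (N powr a) ^ 4 \<le> N powr (1/3 - 4 * a) * (N powr a) ^ 4"
        using elim by (intro mult_right_mono) auto
      also have "\<dots> = N powr (1/3)" using elim by (simp add: powr_power powr_add[symmetric])
      finally show ?case
        using elim K e0 C unfolding a_def
        by (intro allI impI extremal_partial_configuration_structure) auto
    qed
  qed
  have "\<forall>C>0. \<exists>C'>0. \<forall>\<^sub>F N in at_top. \<forall>\<L> \<P> \<J>. extremal_partial_configuration K C e0 N \<L> \<P> \<J> \<longrightarrow>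
      structured_refinement_exists K C (4 * K + 2) C' e0 N \<L> \<P> \<J>"
    if "e0 \<in> {0<..<1 / (24 * (2 * K + 1))}" for e0
  proof (intro allI impI)
    fix C :: real assume "0 < C"
    moreover have "0 < max 2 (2 * C)" by simp
    ultimately show "\<exists>C'>0. \<forall>\<^sub>F N in at_top. \<forall>\<L> \<P> \<J>. extremal_partial_configuration K C e0 N \<L> \<P> \<J> \<longrightarrow>
        structured_refinement_exists K C (4 * K + 2) C' e0 N \<L> \<P> \<J>"
      using main[OF that] by blast
  qed
  moreover have "\<forall>\<^sub>F e0 :: real in at_right 0. e0 \<in> {0<..<1 / (24 * (2 * K + 1))}"
    using K by (intro eventually_at_right_real) auto
  ultimately show "\<exists>K'\<ge>0. \<forall>\<^sub>F e0 in at_right 0. \<forall>C>0. \<exists>C'>0. \<forall>\<^sub>F N in at_top. \<forall>\<L> \<P> \<J>.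
      extremal_partial_configuration K C e0 N \<L> \<P> \<J> \<longrightarrow>
      structured_refinement_exists K C K' C' e0 N \<L> \<P> \<J>"
    using K by (intro exI[of _ "4 * K + 2"] conjI) (auto elim: eventually_mono)
qed

end
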